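(* Suppose $(H,\ell_H)\in\mathcal{G}_{or(n)}$ is an OEB that is canonically self-$\hat\gamma$ for some non-trivial $\hat\gamma\in\mathfrak{S}^n$. Then every graph in its orbit $Orb_\iota(H,\ell_H)$ is also canonically self-$\hat\gamma'$, where $\hat\gamma'$ is a conjugate of $\hat\gamma$ in $\mathfrak{S}^n$.
   Context: **Ribbon graphs.** A (finite) ribbon graph $G=(V(G),E(G))$ is a surface with boundary presented as the union of a set $V(G)$ of discs (vertices) and a set $E(G)$ of discs (edges) such that vertices and edges intersect in disjoint line segments, each such segment lies on the boundary of precisely one vertex and precisely one edge, and every edge contains exactly two such segments. Two ribbon graphs are isomorphic if there is a homeomorphism (not required to preserve any orientation) taking vertices to vertices and edges to edges; equivalently, if the corresponding cellularly embedded graphs are isomorphic. An OEB (orientable embedded bouquet) is a ribbon graph with exactly one vertex that is orientable as a surface. **Arrow presentations.** A ribbon graph is encoded by drawing each vertex boundary as a circle and recording, for each edge $e$, two directed arcs (arrows) labelled $e$ on the circles, namely the two segments where $e$ meets vertices, directed by an arbitrary orientation of the boundary of the disc $e$. **Operations on one edge.** Let $A,B$ be the two arrows labelled $e$. The partial Petrial (twist) $\tau$ at $e$ reverses the direction of exactly one of $A,B$. The partial dual $\delta$ at $e$: draw a segment with an arrow on it labelled $e$ directed from the head of $A$ to the tail of $B$, and another with an arrow labelled $e$ directed from the head of $B$ to the tail of $A$; then delete $A$, $B$ and the arcs containing them. Vertices may change; the set of edges (labels) is unchanged. It is known that the group $\mathfrak{S} = \langle \delta,\tau \mid \delta^2,\tau^2,(\tau\delta)^3\rangle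 \cong S_3$ thereby acts on the left on any fixed edge (in a product the rightmost factor is applied first), and operations on distinct edges commute. **Ordered graphs.** $[n]=\{1,\dots,n\}$. $\mathcal{G}_{or(n)}$ is the set of isomorphism classes of pairs $(G,\ell)$, where $G$ is a ribbon graph with exactly $n$ edges ($n\ge 1$) and $\ell\colon[n]\to E(G)$ is a bijection (a linear ordering of the edges). $(G,\ell_G)$ and $(H,\ell_H)$ are isomorphic if there is a ribbon graph isomorphism $G\to H$ whose edge bijection $g$ satisfies $g\circ\ell_G=\ell_H$. **Group action.** An element $\hat\gamma\in\mathfrak{S}^n$ is regarded as a map $[n]\to\mathfrak{S}$; multiplication and inversion in $\mathfrak{S}^n$ are entrywise, and $\hat\gamma\pi$, for $\pi\in S_n$, is composition of maps. $G^{\Gamma(\hat\gamma,\ell)}$ denotes the ribbon graph obtained from $G$ by applying to each edge $e$ the operation $\hat\gamma(\ell^{-1}(e))$. The group $\mathfrak{S}^n\rtimes S_n$, with multiplication $(\hat\gamma_1,\pi_1)(\hat\gamma_2,\pi_2)=(\hat\gamma_1\cdot\hat\gamma_2\pi_1^{-1},\pi_1\pi_2)$, acts on $\mathcal{G}_{or(n)}$ by $(\hat\gamma,\pi)(G,\ell)=(G^{\Gamma(\hat\gamma,\ell\pi^{-1})},\ell\pi^{-1})$. The identity of $S_n$ is $\iota$. $Orb_\iota(H,\ell_H)=\{(\hat\alpha,\iota)(H,\ell_H) : \hat\alpha\in\mathfrak{S}^n\}$. **Canonically self-$\hat\gamma$.** $(G,\ell)$ is canonically self-$\hat\gamma$ if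 $(\hat\gamma,\iota)(G,\ell)=(G,\ell)$ in $\mathcal{G}_{or(n)}$. *)

theory Defs
  imports "HOL-Analysis.Analysis" "HOL-Algebra.Product_Groups"
begin

section \<open>Ribbon graphs\<close>

definition surface_with_boundary :: "'a topology \<Rightarrow> bool" where
  "surface_with_boundary X \<longleftrightarrow> Hausdorff_space X \<and> second_countable X \<and>
     (\<forall>x \<in> topspace X. \<exists>U W. openin X U \<and> x \<in> U \<and>
        openin (top_of_set {z :: complex. 0 \<le> Im z}) W \<and>
        subtopology X U homeomorphic_space top_of_set W)"

definition disc_chart :: "'a topology \<Rightarrow> 'a set \<Rightarrow> (complex \<Rightarrow> 'a) \<Rightarrow> bool" where
  "disc_chart X D f \<longleftrightarrow> embedding_map (top_of_set (cball 0 1)) X f \<and> f ` cball 0 1 = D"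

definition is_disc :: "'a topology \<Rightarrow> 'a set \<Rightarrow> bool" where
  "is_disc X D \<longleftrightarrow> (\<exists>f. disc_chart X D f)"

text \<open>By invariance of domain all charts of a disc have the same image of the unit circle, so the
  union below is the image of the unit circle under any one of them.\<close>

definition disc_boundary :: "'a topology \<Rightarrow> 'a set \<Rightarrow> 'a set" where
  "disc_boundary X D = (\<Union>f \<in> {f. disc_chart X D f}. f ` sphere 0 1)"

definition arc_between :: "'a topology \<Rightarrow> 'a set \<Rightarrow> 'a \<Rightarrow> 'a \<Rightarrow> bool" where
  "arc_between X S p q \<longleftrightarrow>
     (\<exists>g :: real \<Rightarrow> 'a. embedding_map (top_of_set {0..1}) X g \<and> g ` {0..1} = S \<and> g 0 = p \<and> g 1 = q)"

record 'a ribbon_graph =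
  surface :: "'a topology"
  verts :: "'a set set"
  edges :: "'a set set"

definition attachment :: "'a ribbon_graph \<Rightarrow> 'a set" where
  "attachment G = \<Union>(verts G) \<inter> \<Union>(edges G)"

definition segments :: "'a ribbon_graph \<Rightarrow> 'a set set" where
  "segments G = connected_components_of (subtopology (surface G) (attachment G))"

definition ribbon_graph :: "'a ribbon_graph \<Rightarrow> bool" where
  "ribbon_graph G \<longleftrightarrow>
     surface_with_boundary (surface G) \<and>
     finite (verts G) \<and> finite (edges G) \<and>
     topspace (surface G) = \<Union>(verts G) \<union> \<Union>(edges G) \<and>
     (\<forall>D \<in> verts G \<union> edges G. is_disc (surface G) D) \<and>
     pairwise disjnt (verts G) \<and> pairwise disjnt (edges G) \<and>
     (\<forall>s \<in> segments G. \<exists>p q. arc_between (surface G) s p q) \<and>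
     (\<forall>s \<in> segments G. \<exists>!v. v \<in> verts G \<and> s \<subseteq> disc_boundary (surface G) v) \<and>
     (\<forall>s \<in> segments G. \<exists>!e. e \<in> edges G \<and> s \<subseteq> disc_boundary (surface G) e) \<and>
     (\<forall>e \<in> edges G. card {s \<in> segments G. s \<subseteq> e} = 2)"

text \<open>The unit disc subbundle of the real line bundle over the unit circle whose fibre over
  \<open>u\<^sup>2\<close> is spanned by \<open>u\<close>.\<close>

definition moebius_band :: "(complex \<times> complex) set" where
  "moebius_band = {(u\<^sup>2, of_real t * u) | u t. cmod u = 1 \<and> \<bar>t\<bar> \<le> 1}"

definition orientable :: "'a topology \<Rightarrow> bool" where
  "orientable X \<longleftrightarrow>
     \<not> (\<exists>M \<subseteq> topspace X. subtopology X M homeomorphic_space top_of_set moebius_band)"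

definition oeb :: "'a ribbon_graph \<Rightarrow> bool" where
  "oeb G \<longleftrightarrow> ribbon_graph G \<and> card (verts G) = 1 \<and> orientable (surface G)"


section \<open>Ordered ribbon graphs up to isomorphism\<close>

text \<open>The values of an ordering outside \<open>{1..n}\<close> are irrelevant: isomorphism does not see them.\<close>

definition ordered_graphs :: "nat \<Rightarrow> ('a ribbon_graph \<times> (nat \<Rightarrow> 'a set)) set" where
  "ordered_graphs n =
     {(G, l). ribbon_graph G \<and> card (edges G) = n \<and> bij_betw l {1..n} (edges G)}"

definition ordered_iso ::
  "nat \<Rightarrow> (('a ribbon_graph \<times> (nat \<Rightarrow> 'a set)) \<times> ('a ribbon_graph \<times> (nat \<Rightarrow> 'a set))) set" where
  "ordered_iso n =
     {((G, lG), (H, lH)). (G, lG) \<in> ordered_graphs n \<and> (H, lH) \<in> ordered_graphs n \<and>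
        (\<exists>f. homeomorphic_map (surface G) (surface H) f \<and>
             (\<lambda>v. f ` v) ` verts G = verts H \<and> (\<lambda>e. f ` e) ` edges G = edges H \<and>
             (\<forall>i \<in> {1..n}. f ` lG i = lH i))}"

text \<open>The elements of the quotient \<open>ordered_graphs n // ordered_iso n\<close> are the classes below.\<close>

definition iso_class ::
  "nat \<Rightarrow> 'a ribbon_graph \<Rightarrow> (nat \<Rightarrow> 'a set) \<Rightarrow> ('a ribbon_graph \<times> (nat \<Rightarrow> 'a set)) set" where
  "iso_class n G l = ordered_iso n `` {(G, l)}"


section \<open>Arrow presentations\<close>

text \<open>The two arrows labelled \<open>i\<close> are \<open>(i, ArrA)\<close> and \<open>(i, ArrB)\<close>. The arrows cut every circle that
  carries at least one of them into arrow-free arcs, each joining two arrow ends (the tail and the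
  head of the same arrow if this is the only one on its circle). An arrow presentation is recorded
  by these pairs of ends together with the number of circles that carry no arrow; going
  alternately along arrows and arrow-free arcs recovers the other circles.\<close>

datatype arrow = ArrA | ArrB
datatype tip = Tail | Head

type_synonym arrow_end = "nat \<times> arrow \<times> tip"

record arrow_presentation =
  free_arcs :: "arrow_end set set"
  bare_circles :: nat

text \<open>\<open>presents n P G l\<close>: \<open>P\<close> is an arrow presentation of \<open>G\<close> in which the arrows of the edge \<open>l i\<close>
  are labelled \<open>i\<close>. The map \<open>pos\<close> gives the position of each arrow end in the surface. The arrows
  are directed along \<open>\<lambda>t. f (cis t)\<close>, which is an orientation of the boundary of the edge; since \<open>f\<close>
  may be replaced by \<open>f \<circ> cnj\<close>, both orientations are allowed.\<close>

definition presents ::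
  "nat \<Rightarrow> arrow_presentation \<Rightarrow> 'a ribbon_graph \<Rightarrow> (nat \<Rightarrow> 'a set) \<Rightarrow> bool" where
  "presents n P G l \<longleftrightarrow>
     (\<exists>pos :: arrow_end \<Rightarrow> 'a.
        (\<forall>i \<in> {1..n}. \<exists>f a b c d.
           disc_chart (surface G) (l i) f \<and> a < b \<and> b < c \<and> c < d \<and> d < a + 2 * pi \<and>
           (\<lambda>t. f (cis t)) ` {a..b} \<in> segments G \<and> (\<lambda>t. f (cis t)) ` {c..d} \<in> segments G \<and>
           pos (i, ArrA, Tail) = f (cis a) \<and> pos (i, ArrA, Head) = f (cis b) \<and>
           pos (i, ArrB, Tail) = f (cis c) \<and> pos (i, ArrB, Head) = f (cis d)) \<and>
        free_arcs P =
          {{p, q} | p q. p \<in> {1..n} \<times> UNIV \<and> q \<in> {1..n} \<times> UNIV \<and>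
             (\<exists>v \<in> verts G. \<exists>S \<subseteq> disc_boundary (surface G) v.
                arc_between (surface G) S (pos p) (pos q) \<and>
                S \<inter> attachment G = {pos p, pos q})} \<and>
        bare_circles P = card {v \<in> verts G. \<forall>s \<in> segments G. \<not> s \<subseteq> v})"


section \<open>Partial duals, partial Petrials and the group they generate\<close>

datatype gen = Delta | Tau

text \<open>Both operations keep the arrow-free arcs and only change the arrows of one label, so they are
  given by the new name of each old arrow end. Under the partial dual, the new arrow \<open>ArrA\<close> runs from
  the head of the old \<open>ArrA\<close> to the tail of the old \<open>ArrB\<close>, and the new \<open>ArrB\<close> from the head of the
  old \<open>ArrB\<close> to the tail of the old \<open>ArrA\<close>. The partial Petrial reverses \<open>ArrA\<close>; reversing \<open>ArrB\<close>
  instead presents the same ribbon graph.\<close>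

fun rename :: "gen \<Rightarrow> arrow \<times> tip \<Rightarrow> arrow \<times> tip" where
  "rename Delta (ArrA, Head) = (ArrA, Tail)"
| "rename Delta (ArrB, Tail) = (ArrA, Head)"
| "rename Delta (ArrB, Head) = (ArrB, Tail)"
| "rename Delta (ArrA, Tail) = (ArrB, Head)"
| "rename Tau (ArrA, Tail) = (ArrA, Head)"
| "rename Tau (ArrA, Head) = (ArrA, Tail)"
| "rename Tau (ArrB, t) = (ArrB, t)"

text \<open>\<open>foldr\<close> applies the rightmost letter of a word first.\<close>

definition apply_words :: "(nat \<Rightarrow> gen list) \<Rightarrow> arrow_presentation \<Rightarrow> arrow_presentation" where
  "apply_words w P =
     P\<lparr>free_arcs := (\<lambda>c. (\<lambda>(i, x). (i, foldr rename (w i) x)) ` c) ` free_arcs P\<rparr>"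

text \<open>The group presented by \<open>\<langle>\<delta>, \<tau> | \<delta>\<^sup>2, \<tau>\<^sup>2, (\<tau>\<delta>)\<^sup>3\<rangle>\<close>. The relators make \<open>\<delta>\<close> and \<open>\<tau>\<close> their own
  inverses, so words without inverse letters suffice.\<close>

definition relators :: "gen list set" where
  "relators = {[Delta, Delta], [Tau, Tau], [Tau, Delta, Tau, Delta, Tau, Delta]}"

inductive word_eq :: "gen list \<Rightarrow> gen list \<Rightarrow> bool" where
  word_eq_relator: "r \<in> relators \<Longrightarrow> word_eq (u @ r @ v) (u @ v)"
| word_eq_refl: "word_eq u u"
| word_eq_sym: "word_eq u v \<Longrightarrow> word_eq v u"
| word_eq_trans: "word_eq u v \<Longrightarrow> word_eq v w \<Longrightarrow> word_eq u w"

quotient_type ribbon_op = "gen list" / word_eq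
  by (intro equivpI reflpI sympI transpI) (auto intro: word_eq.intros)

lemma word_eq_append_left: "word_eq u v \<Longrightarrow> word_eq (x @ u) (x @ v)"
proof (induction rule: word_eq.induct)
  case (word_eq_relator r u v)
  then show ?case using word_eq.word_eq_relator[of r "x @ u" v] by simp
qed (auto intro: word_eq.intros)

lemma word_eq_append_right: "word_eq u v \<Longrightarrow> word_eq (u @ x) (v @ x)"
proof (induction rule: word_eq.induct)
  case (word_eq_relator r u v)
  then show ?case using word_eq.word_eq_relator[of r u "v @ x"] by simp
qed (auto intro: word_eq.intros)

lift_definition op_mult :: "ribbon_op \<Rightarrow> ribbon_op \<Rightarrow> ribbon_op" is "(@)"
  by (blast intro: word_eq_append_left word_eq_append_right word_eq_trans)

lift_definition op_one :: ribbon_op is "[]" .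

lift_definition op_of_word :: "gen list \<Rightarrow> ribbon_op" is "\<lambda>w. w" .

definition ribbon_group :: "ribbon_op monoid" where
  "ribbon_group = \<lparr>carrier = UNIV, mult = op_mult, one = op_one\<rparr>"

lemma word_eq_rev_append: "word_eq (rev w @ w) []"
proof (induction w)
  case (Cons g w)
  have "[g, g] \<in> relators"
    by (cases g) (auto simp: relators_def)
  then have "word_eq (rev w @ [g, g] @ w) (rev w @ w)"
    by (rule word_eq_relator)
  with Cons show ?case
    by (auto intro: word_eq_trans)
qed (simp add: word_eq_refl)

lemma group_ribbon_group: "group ribbon_group"
proof (rule groupI)
  fix x assume "x \<in> carrier ribbon_group"
  have "\<exists>y. op_mult y x = op_one"
    by transfer (use word_eq_rev_append in blast)
  then show "\<exists>y \<in> carrier ribbon_group. y \<otimes>\<^bsub>ribbon_group\<^esub> x = \<one>\<^bsub>ribbon_group\<^esub>"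
    by (simp add: ribbon_group_def)
qed (simp_all add: ribbon_group_def, (transfer, simp add: word_eq_refl)+)

definition ribbon_group_power :: "nat \<Rightarrow> (nat \<Rightarrow> ribbon_op) monoid" where
  "ribbon_group_power n = product_group {1..n} (\<lambda>_. ribbon_group)"


section \<open>The action on ordered ribbon graphs\<close>

text \<open>\<open>ribbon_change n \<gamma> G m G' m'\<close>: \<open>G'\<close> is \<open>G\<^bsup>\<Gamma>(\<gamma>, m)\<^esup>\<close>, and \<open>m'\<close> is the ordering \<open>m\<close>
  carried over to \<open>G'\<close> by the edge labels, which the operations preserve.\<close>

definition ribbon_change ::
  "nat \<Rightarrow> (nat \<Rightarrow> ribbon_op) \<Rightarrow> 'a ribbon_graph \<Rightarrow> (nat \<Rightarrow> 'a set) \<Rightarrow>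
     'a ribbon_graph \<Rightarrow> (nat \<Rightarrow> 'a set) \<Rightarrow> bool" where
  "ribbon_change n \<gamma> G m G' m' \<longleftrightarrow>
     (\<exists>P w. presents n P G m \<and> (\<forall>i \<in> {1..n}. op_of_word (w i) = \<gamma> i) \<and>
            presents n (apply_words w P) G' m')"

text \<open>Acting on an isomorphism class means acting on its members and taking everything isomorphic
  to the results.\<close>

definition act ::
  "nat \<Rightarrow> (nat \<Rightarrow> ribbon_op) \<times> (nat \<Rightarrow> nat) \<Rightarrow>
     ('a ribbon_graph \<times> (nat \<Rightarrow> 'a set)) set \<Rightarrow> ('a ribbon_graph \<times> (nat \<Rightarrow> 'a set)) set" where
  "act n = (\<lambda>(\<gamma>, \<pi>) C.
     {(G', l') \<in> ordered_graphs n.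
        \<exists>(G, l) \<in> C. ribbon_change n \<gamma> G (l \<circ> inv_into UNIV \<pi>) G' l'})"

definition Orb_id ::
  "nat \<Rightarrow> ('a ribbon_graph \<times> (nat \<Rightarrow> 'a set)) set \<Rightarrow> ('a ribbon_graph \<times> (nat \<Rightarrow> 'a set)) set set" where
  "Orb_id n C = {act n (\<alpha>, id) C | \<alpha>. \<alpha> \<in> carrier (ribbon_group_power n)}"

definition canonically_self ::
  "nat \<Rightarrow> (nat \<Rightarrow> ribbon_op) \<Rightarrow> ('a ribbon_graph \<times> (nat \<Rightarrow> 'a set)) set \<Rightarrow> bool" where
  "canonically_self n \<gamma> C \<longleftrightarrow> act n (\<gamma>, id) C = C"

end

theory Submission
  imports Defs
begin

text \<open>The claim has the shape of a fact about group actions: if \<open>\<gamma>\<close> fixes \<open>C\<close>, then \<open>\<alpha>\<gamma>\<alpha>\<^sup>-\<^sup>1\<close> fixes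
  \<open>\<alpha>C\<close>. What has to be shown is that acting on ribbon graphs through arrow presentations is
  independent enough of the chosen presentation for this computation to make sense.

  An ordered ribbon graph does not determine its arrow presentation: at each edge the two arrows may
  exchange their names, and both may be reversed together. These choices form a Klein four-group of
  permutations of the four arrow ends of an edge, called \<open>turns\<close> below. All of them occur
  (\<open>presents_turn_equiv\<close>), and there is no other ambiguity (\<open>presents_unique\<close>). The second fact is the
  topological heart of the matter. Two charts of an edge differ by a homeomorphism of the closed unit
  disc, which by invariance of domain maps the circle to itself. It matches up the two segments where
  the edge meets vertices, and therefore also the ends of these segments; and it cannot reverse
  exactly one of the segments, because the part of the circle between them would then have to
  connect two points that the segments separate (\<open>no_single_reversal\<close>).

  On the four arrow ends, \<open>\<delta>\<close> acts as a 4-cycle and \<open>\<tau>\<close> as a transposition. They generate the full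
  symmetric group, in which the Klein four-group is normal with quotient isomorphic to the group of
  ribbon operations. Normality makes renaming compatible with turns
  (\<open>apply_words_turn_equiv\<close>); that the relators act as turns makes words for the same operation
  agree up to turns (\<open>apply_words_cong\<close>). Hence whether an operation leads from one graph to another
  can be decided on any presentation of the first and with any words (\<open>ribbon_change_iff\<close>).

  Now let \<open>\<gamma>\<close> fix the class \<open>C\<close> of \<open>H\<close>. If \<open>P\<close> presents a member \<open>G\<close> of \<open>C\<close>, then so does the
  presentation \<open>\<gamma>P\<close> (\<open>self_presentation\<close>). If moreover \<open>\<alpha>P\<close> presents \<open>K\<close>, then \<open>\<alpha>\<gamma>\<alpha>\<^sup>-\<^sup>1\<close> carries \<open>\<alpha>P\<close>
  to \<open>\<alpha>\<gamma>P\<close>, which agrees with \<open>\<alpha>P\<close> up to turns. So \<open>\<alpha>\<gamma>\<alpha>\<^sup>-\<^sup>1\<close> leads from \<open>K\<close> to exactly the graphs to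
  which \<open>\<alpha>\<close> leads from \<open>G\<close>, among them \<open>K\<close> itself. Only graphs that are already given occur in this
  argument, so no abstract arrow presentation ever has to be realized by a surface.\<close>

section \<open>Renamings of the arrow ends\<close>

fun other_arrow :: "arrow \<Rightarrow> arrow" where
  "other_arrow ArrA = ArrB"
| "other_arrow ArrB = ArrA"

fun other_tip :: "tip \<Rightarrow> tip" where
  "other_tip Tail = Head"
| "other_tip Head = Tail"

definition swap_arrows :: "arrow \<times> tip \<Rightarrow> arrow \<times> tip" where
  "swap_arrows = map_prod other_arrow id"

definition reverse_arrows :: "arrow \<times> tip \<Rightarrow> arrow \<times> tip" where
  "reverse_arrows = map_prod id other_tip"

text \<open>The renamings of the ends of one edge that a ribbon graph does not see. The exchange of the two
  names and the reversal of both arrows commute, so these four form a group.\<close>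

definition turns :: "(arrow \<times> tip \<Rightarrow> arrow \<times> tip) set" where
  "turns = {id, swap_arrows, reverse_arrows, swap_arrows \<circ> reverse_arrows}"

lemma arrow_tip_fun_eqI:
  assumes "f (ArrA, Tail) = g (ArrA, Tail)" "f (ArrA, Head) = g (ArrA, Head)"
    "f (ArrB, Tail) = g (ArrB, Tail)" "f (ArrB, Head) = g (ArrB, Head)"
  shows "f = g"
proof
  fix x :: "arrow \<times> tip"
  obtain a t where "x = (a, t)" by (cases x)
  then show "f x = g x" using assms by (cases a; cases t) auto
qed

lemma id_in_turns: "id \<in> turns"
  by (simp add: turns_def)

lemma turns_cases:
  assumes "k \<in> turns"
  obtains "k = id" | "k = swap_arrows" | "k = reverse_arrows" | "k = swap_arrows \<circ> reverse_arrows"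
  using assms by (auto simp: turns_def)

lemma turns_involution: "k \<in> turns \<Longrightarrow> k \<circ> k = id"
  by (erule turns_cases; rule arrow_tip_fun_eqI) (simp_all add: swap_arrows_def reverse_arrows_def)

lemma turns_involution_apply: "k \<in> turns \<Longrightarrow> k (k x) = x"
  using turns_involution by (metis comp_apply id_apply)

lemma turns_comp:
  assumes "k \<in> turns" "k' \<in> turns"
  shows "k \<circ> k' \<in> turns"
proof -
  have 1: "swap_arrows \<circ> swap_arrows = id" "reverse_arrows \<circ> reverse_arrows = id"
    "reverse_arrows \<circ> swap_arrows = swap_arrows \<circ> reverse_arrows"
    by (rule arrow_tip_fun_eqI; simp add: swap_arrows_def reverse_arrows_def)+
  have 2: "swap_arrows \<circ> (swap_arrows \<circ> f) = f" "reverse_arrows \<circ> (reverse_arrows \<circ> f) = f"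
    "reverse_arrows \<circ> (swap_arrows \<circ> f) = swap_arrows \<circ> (reverse_arrows \<circ> f)" for f :: "arrow \<times> tip \<Rightarrow> arrow \<times> tip"
    by (metis 1 comp_assoc id_comp)+
  show ?thesis
    using assms by (auto simp: turns_def comp_assoc 1 2)
qed

text \<open>The Klein four-group is normal in the symmetric group on the four arrow ends; it suffices to check
  this on the two generators.\<close>

lemma rename_turn:
  assumes "k \<in> turns"
  shows "\<exists>k' \<in> turns. rename g \<circ> k = k' \<circ> rename g"
proof -
  let ?s = swap_arrows and ?r = reverse_arrows
  have D: "rename Delta \<circ> ?s = ?s \<circ> rename Delta"
    "rename Delta \<circ> ?r = (?s \<circ> ?r) \<circ> rename Delta"
    "rename Delta \<circ> (?s \<circ> ?r) = ?r \<circ> rename Delta"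
    by (rule arrow_tip_fun_eqI; simp add: swap_arrows_def reverse_arrows_def)+
  have T: "rename Tau \<circ> ?s = (?s \<circ> ?r) \<circ> rename Tau"
    "rename Tau \<circ> ?r = ?r \<circ> rename Tau"
    "rename Tau \<circ> (?s \<circ> ?r) = ?s \<circ> rename Tau"
    by (rule arrow_tip_fun_eqI; simp add: swap_arrows_def reverse_arrows_def)+
  have I: "rename g \<circ> id = id \<circ> rename g" by simp
  have mem: "id \<in> turns" "?s \<in> turns" "?r \<in> turns" "?s \<circ> ?r \<in> turns"
    by (simp_all add: turns_def)
  from assms show ?thesis
  proof (cases rule: turns_cases)
    case 1 then show ?thesis using I mem(1) by blast
  next
    case 2 then show ?thesis using D(1) T(1) mem by (cases g) blast+
  next
    case 3 then show ?thesis using D(2) T(2) mem by (cases g) blast+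
  next
    case 4 then show ?thesis using D(3) T(3) mem by (cases g) blast+
  qed
qed

lemma foldr_rename_turn:
  assumes "k \<in> turns"
  shows "\<exists>k' \<in> turns. foldr rename w \<circ> k = k' \<circ> foldr rename w"
proof (induction w)
  case Nil
  then show ?case using assms by auto
next
  case (Cons g w)
  then obtain k' where k': "k' \<in> turns" "foldr rename w \<circ> k = k' \<circ> foldr rename w" by blast
  obtain k'' where "k'' \<in> turns" "rename g \<circ> k' = k'' \<circ> rename g"
    using rename_turn[OF k'(1)] by blast
  moreover have "foldr rename (g # w) \<circ> k = rename g \<circ> (foldr rename w \<circ> k)"
    "k'' \<circ> foldr rename (g # w) = (k'' \<circ> rename g) \<circ> foldr rename w"
    by (simp_all add: comp_assoc)
  ultimately have "foldr rename (g # w) \<circ> k = k'' \<circ> foldr rename (g # w)"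
    by (simp only: k'(2) comp_assoc[symmetric])
  then show ?case using \<open>k'' \<in> turns\<close> by blast
qed

lemma foldr_rename_append: "foldr rename (u @ v) = foldr rename u \<circ> foldr rename v"
  by auto

lemma relator_turn: "r \<in> relators \<Longrightarrow> foldr rename r \<in> turns"
proof -
  assume "r \<in> relators"
  moreover have "foldr rename [Delta, Delta] = swap_arrows"
    "foldr rename [Tau, Tau] = id"
    "foldr rename [Tau, Delta, Tau, Delta, Tau, Delta] = id"
    by (rule arrow_tip_fun_eqI; simp add: swap_arrows_def)+
  ultimately show ?thesis by (auto simp: relators_def turns_def simp del: foldr.simps)
qed

text \<open>Sending words to permutations of the arrow ends is well defined on ribbon operations only modulo
  turns: \<open>[Delta, Delta]\<close> exchanges the names of the two arrows. By normality a relator inside a word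
  can be moved to the front as a turn.\<close>

lemma word_eq_turn:
  assumes "word_eq u v"
  shows "\<exists>k \<in> turns. foldr rename u = k \<circ> foldr rename v"
  using assms
proof (induction rule: word_eq.induct)
  case (word_eq_relator r u v)
  obtain k where k: "k \<in> turns" "foldr rename u \<circ> foldr rename r = k \<circ> foldr rename u"
    using foldr_rename_turn[OF relator_turn[OF word_eq_relator]] by blast
  have "foldr rename (u @ r @ v) = k \<circ> foldr rename (u @ v)"
    unfolding foldr_rename_append comp_assoc[symmetric] k(2) ..
  then show ?case using k(1) by blast
next
  case (word_eq_refl u)
  then show ?case using id_in_turns by (intro bexI[of _ id]) simp_all
next
  case (word_eq_sym u v)
  then obtain k where "k \<in> turns" "foldr rename u = k \<circ> foldr rename v" by blast
  then show ?case
    by (intro bexI[of _ k]) (simp_all add: fun_eq_iff turns_involution_apply)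
next
  case (word_eq_trans u v w)
  then obtain k k' where "k \<in> turns" "foldr rename u = k \<circ> foldr rename v"
    "k' \<in> turns" "foldr rename v = k' \<circ> foldr rename w" by blast
  then show ?case
    by (intro bexI[of _ "k \<circ> k'"]) (simp_all add: turns_comp comp_assoc)
qed

section \<open>Relabelled arrow presentations\<close>

definition relabel_arc ::
  "(nat \<Rightarrow> arrow \<times> tip \<Rightarrow> arrow \<times> tip) \<Rightarrow> arrow_end set \<Rightarrow> arrow_end set" where
  "relabel_arc \<sigma> c = (\<lambda>(i, x). (i, \<sigma> i x)) ` c"

definition relabel ::
  "(nat \<Rightarrow> arrow \<times> tip \<Rightarrow> arrow \<times> tip) \<Rightarrow> arrow_presentation \<Rightarrow> arrow_presentation" where
  "relabel \<sigma> P = P\<lparr>free_arcs := relabel_arc \<sigma> ` free_arcs P\<rparr>"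

lemma relabel_arc_comp: "relabel_arc \<sigma> (relabel_arc \<tau> c) = relabel_arc (\<lambda>i. \<sigma> i \<circ> \<tau> i) c"
  by (force simp: relabel_arc_def)

lemma relabel_comp: "relabel \<sigma> (relabel \<tau> P) = relabel (\<lambda>i. \<sigma> i \<circ> \<tau> i) P"
  by (simp add: relabel_def image_image relabel_arc_comp)

lemma relabel_arc_id: "relabel_arc (\<lambda>_. id) c = c"
  by (force simp: relabel_arc_def)

lemma relabel_id: "relabel (\<lambda>_. id) P = P"
  by (simp add: relabel_def relabel_arc_id)

lemma relabel_cong:
  assumes "\<And>c. c \<in> free_arcs P \<Longrightarrow> c \<subseteq> {1..n} \<times> UNIV" "\<And>i. i \<in> {1..n} \<Longrightarrow> \<sigma> i = \<tau> i"
  shows "relabel \<sigma> P = relabel \<tau> P"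
proof -
  have "relabel_arc \<sigma> c = relabel_arc \<tau> c" if "c \<in> free_arcs P" for c
    unfolding relabel_arc_def using assms(1)[OF that] assms(2)
    by (intro image_cong) auto
  then show ?thesis by (simp add: relabel_def)
qed

lemma apply_words_relabel: "apply_words w P = relabel (\<lambda>i. foldr rename (w i)) P"
  by (simp add: apply_words_def relabel_def relabel_arc_def[abs_def])

lemma apply_words_append: "apply_words (\<lambda>i. u i @ v i) P = apply_words u (apply_words v P)"
  by (simp add: apply_words_relabel relabel_comp foldr_rename_append)

text \<open>Two presentations that differ only in choices invisible in the ribbon graph.\<close>

definition turn_equiv :: "arrow_presentation \<Rightarrow> arrow_presentation \<Rightarrow> bool" where
  "turn_equiv P Q \<longleftrightarrow> (\<exists>\<sigma>. (\<forall>i. \<sigma> i \<in> turns) \<and> Q = relabel \<sigma> P)"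

lemma turn_equiv_sym:
  assumes "turn_equiv P Q"
  shows "turn_equiv Q P"
proof -
  obtain \<sigma> where s: "\<forall>i. \<sigma> i \<in> turns" "Q = relabel \<sigma> P"
    using assms by (auto simp: turn_equiv_def)
  then have "relabel \<sigma> Q = P"
    by (simp add: relabel_comp turns_involution relabel_id)
  then show ?thesis using s(1) by (auto simp: turn_equiv_def)
qed

lemma turn_equiv_trans:
  assumes "turn_equiv P Q" "turn_equiv Q R"
  shows "turn_equiv P R"
proof -
  obtain \<sigma> \<tau> where "\<forall>i. \<sigma> i \<in> turns" "Q = relabel \<sigma> P" "\<forall>i. \<tau> i \<in> turns" "R = relabel \<tau> Q"
    using assms by (auto simp: turn_equiv_def)
  then show ?thesis
    unfolding turn_equiv_def by (intro exI[of _ "\<lambda>i. \<tau> i \<circ> \<sigma> i"]) (simp add: turns_comp relabel_comp)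
qed

lemma apply_words_turn_equiv:
  assumes "turn_equiv P Q"
  shows "turn_equiv (apply_words w P) (apply_words w Q)"
proof -
  obtain \<sigma> where s: "\<forall>i. \<sigma> i \<in> turns" "Q = relabel \<sigma> P"
    using assms by (auto simp: turn_equiv_def)
  have "\<forall>i. \<exists>k \<in> turns. foldr rename (w i) \<circ> \<sigma> i = k \<circ> foldr rename (w i)"
    using s(1) foldr_rename_turn by blast
  then obtain \<tau> where t: "\<And>i. \<tau> i \<in> turns"
      "\<And>i. foldr rename (w i) \<circ> \<sigma> i = \<tau> i \<circ> foldr rename (w i)"
    by metis
  then have "apply_words w Q = relabel \<tau> (apply_words w P)"
    by (simp add: s(2) apply_words_relabel relabel_comp)
  then show ?thesis using t(1) by (auto simp: turn_equiv_def)
qed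

lemma apply_words_cong:
  assumes "\<And>c. c \<in> free_arcs P \<Longrightarrow> c \<subseteq> {1..n} \<times> UNIV"
    and "\<And>i. i \<in> {1..n} \<Longrightarrow> op_of_word (u i) = op_of_word (v i)"
  shows "turn_equiv (apply_words u P) (apply_words v P)"
proof -
  have "word_eq (v i) (u i)" if "i \<in> {1..n}" for i
    using assms(2)[OF that] by transfer (rule word_eq_sym)
  then have "\<forall>i. \<exists>k \<in> turns. i \<in> {1..n} \<longrightarrow> foldr rename (v i) = k \<circ> foldr rename (u i)"
    using word_eq_turn id_in_turns by blast
  then obtain \<tau> where t: "\<And>i. \<tau> i \<in> turns"
      "\<And>i. i \<in> {1..n} \<Longrightarrow> foldr rename (v i) = \<tau> i \<circ> foldr rename (u i)"
    by metis
  have "apply_words v P = relabel \<tau> (apply_words u P)"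
    unfolding apply_words_relabel relabel_comp
    by (rule relabel_cong[OF assms(1)]) (auto simp: t(2))
  then show ?thesis using t(1) by (auto simp: turn_equiv_def)
qed

section \<open>Two arcs on the boundary of a disc\<close>

lemma inj_on_cis: "inj_on cis {a..<a + 2 * pi}"
proof (rule inj_onI)
  fix x y assume *: "x \<in> {a..<a + 2 * pi}" "y \<in> {a..<a + 2 * pi}" "cis x = cis y"
  have "cis (x - y) = 1" using *(3) by (simp flip: cis_divide)
  then have "cos (x - y) = 1" by (simp add: complex_eq_iff)
  then obtain m :: int where m: "x - y = of_int m * (2 * pi)"
    using cos_one_2pi_int by (metis mult.assoc)
  have "\<bar>x - y\<bar> < 2 * pi" using * by (auto simp: abs_if)
  then have "\<bar>of_int m\<bar> * (2 * pi) < 1 * (2 * pi)" by (simp add: m abs_mult)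
  then have "\<bar>of_int m :: real\<bar> < 1" by simp
  then have "m = 0" by linarith
  then show "x = y" using m by simp
qed

lemma continuous_on_cis_real: "continuous_on A cis"
  by (rule continuous_on_cis) (rule continuous_on_id)

text \<open>The open disc has an open image, which lies in the interior of the closed disc; the same holds for
  the inverse map.\<close>

lemma disc_homeo_circle:
  fixes h :: "complex \<Rightarrow> complex"
  assumes "continuous_on (cball 0 1) h" "inj_on h (cball 0 1)" "h ` cball 0 1 = cball 0 1"
  shows "h ` sphere 0 1 = sphere 0 1"
proof -
  have into: "g ` ball 0 1 \<subseteq> ball 0 1"
    if "continuous_on (cball 0 1) g" "inj_on g (cball 0 1)" "g ` cball 0 1 = cball 0 1"
    for g :: "complex \<Rightarrow> complex"
  proof -
    have "open (g ` ball 0 1)"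
      using that by (intro invariance_of_domain)
        (auto intro: continuous_on_subset inj_on_subset)
    moreover have "g ` ball 0 1 \<subseteq> cball 0 1"
      using that(3) by (metis ball_subset_cball image_mono)
    ultimately show ?thesis
      by (metis interior_cball interior_maximal)
  qed
  define g where "g = the_inv_into (cball 0 1) h"
  have g: "continuous_on (cball 0 1) g" "inj_on g (cball 0 1)" "g ` cball 0 1 = cball 0 1"
    using continuous_on_inv_into[OF assms(1) compact_cball assms(2)] assms
      inj_on_the_inv_into[OF assms(2)] the_inv_into_onto[OF assms(2)]
    by (simp_all add: g_def)
  have "h ` ball 0 1 = ball 0 1"
  proof
    show "ball 0 1 \<subseteq> h ` ball 0 1"
    proof
      fix z :: complex assume z: "z \<in> ball 0 1"
      then have "g z \<in> ball 0 1" using into[OF g] by blast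
      moreover have "h (g z) = z"
        unfolding g_def using z assms(3) by (intro f_the_inv_into_f[OF assms(2)]) auto
      ultimately show "z \<in> h ` ball 0 1" by (metis imageI)
    qed
  qed (rule into[OF assms])
  moreover have "sphere 0 1 = cball 0 1 - ball (0::complex) 1" by auto
  ultimately show ?thesis
    using inj_on_image_set_diff[OF assms(2), of "cball 0 1" "ball 0 1"] assms(3) by auto
qed

text \<open>Comparing the two parametrizations gives a continuous injection between intervals. Being strictly
  monotone, it takes extreme values only at the ends.\<close>

lemma arc_endpoints:
  fixes u v :: "real \<Rightarrow> 'b::t2_space"
  assumes "a < b" "a' < b'" "continuous_on {a..b} u" "inj_on u {a..b}"
    and "continuous_on {a'..b'} v" "inj_on v {a'..b'}" "u ` {a..b} = v ` {a'..b'}"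
  shows "u a = v a' \<and> u b = v b' \<or> u a = v b' \<and> u b = v a'"
proof -
  define k where "k = the_inv_into {a'..b'} v \<circ> u"
  have vk: "v (k x) = u x" "k x \<in> {a'..b'}" if "x \<in> {a..b}" for x
  proof -
    have "u x \<in> v ` {a'..b'}" using that assms(7) by blast
    then show "v (k x) = u x" "k x \<in> {a'..b'}"
      using f_the_inv_into_f[OF assms(6)] the_inv_into_into[OF assms(6) _ order.refl]
      by (simp_all add: k_def)
  qed
  have cont: "continuous_on {a..b} k"
    unfolding k_def
    using continuous_on_inv_into[OF assms(5) compact_Icc assms(6)] assms(3,7)
    by (intro continuous_on_compose) auto
  have inj: "inj_on k {a..b}"
    by (rule inj_onI) (metis vk(1) assms(4) inj_onD)
  have between: "k a < k x \<and> k x < k b \<or> k b < k x \<and> k x < k a" if "a < x" "x < b" for x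
    using continuous_inj_imp_mono[OF that cont inj] by blast
  have end_only: "x = a \<or> x = b" if "x \<in> {a..b}" "k x = a' \<or> k x = b'" for x
  proof (rule ccontr)
    assume "\<not> (x = a \<or> x = b)"
    then have "a < x" "x < b" using that(1) by simp_all
    then have "k a < k x \<and> k x < k b \<or> k b < k x \<and> k x < k a" by (rule between)
    moreover have "k a \<in> {a'..b'}" "k b \<in> {a'..b'}" using vk(2) \<open>a < b\<close> by simp_all
    ultimately show False using that(2) by simp linarith
  qed
  have onto: "\<exists>x \<in> {a..b}. k x = y" if "y \<in> {a'..b'}" for y
  proof -
    have "v y \<in> u ` {a..b}" using assms(7) that by simp
    then obtain x where x: "x \<in> {a..b}" "u x = v y" by force
    have "k x = y"
      using inj_onD[OF assms(6) _ vk(2)[OF x(1)] that] vk(1)[OF x(1)] x(2) by simp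
    then show ?thesis using x(1) by blast
  qed
  have "a' \<in> {a'..b'}" "b' \<in> {a'..b'}" using \<open>a' < b'\<close> by simp_all
  then obtain x y where xy: "x \<in> {a..b}" "k x = a'" "y \<in> {a..b}" "k y = b'"
    using onto by blast
  have "x \<noteq> y" using xy \<open>a' < b'\<close> by blast
  then have "x = a \<and> y = b \<or> x = b \<and> y = a"
    using end_only xy by blast
  then show ?thesis using vk(1)[OF xy(1)] vk(1)[OF xy(3)] xy(2,4) by auto
qed

definition cyclic_angles :: "real \<Rightarrow> real \<Rightarrow> real \<Rightarrow> real \<Rightarrow> bool" where
  "cyclic_angles a b c d \<longleftrightarrow> a < b \<and> b < c \<and> c < d \<and> d < a + 2 * pi"

lemma cis_full_turn: "cis (x + 2 * pi) = cis x"
  by (simp flip: cis_mult)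

lemma cis_shift: "cis ` {a + 2 * pi..b + 2 * pi} = cis ` {a..b}"
proof -
  have *: "{a + 2 * pi..b + 2 * pi} = (\<lambda>t. t + 2 * pi) ` {a..b}" by simp
  have "cis ` {a + 2 * pi..b + 2 * pi} = (\<lambda>t. cis (t + 2 * pi)) ` {a..b}"
    by (simp only: * image_image)
  then show ?thesis by (simp add: cis_full_turn)
qed

lemma circle_eq: "sphere 0 1 = cis ` {a..<a + 2 * pi}"
proof
  show "sphere 0 1 \<subseteq> cis ` {a..<a + 2 * pi}"
  proof
    fix z :: complex assume "z \<in> sphere 0 1"
    then have "cmod z = 1" by simp
    then have z: "z = cis (Arg z)" using rcis_cmod_Arg[of z] by (simp add: rcis_def)
    define m where "m = \<lfloor>(Arg z - a) / (2 * pi)\<rfloor>"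
    define t where "t = Arg z - of_int m * (2 * pi)"
    have "of_int m \<le> (Arg z - a) / (2 * pi)" "(Arg z - a) / (2 * pi) < of_int m + 1"
      unfolding m_def by linarith+
    then have "of_int m * (2 * pi) \<le> Arg z - a" "Arg z - a < (of_int m + 1) * (2 * pi)"
      by (simp_all add: pos_le_divide_eq pos_divide_less_eq)
    then have "t \<in> {a..<a + 2 * pi}" by (simp add: t_def algebra_simps)
    moreover have "cis t = z"
    proof -
      have "cis (2 * pi * of_int m) = 1" by (rule cis_multiple_2pi) simp
      then have "cis t = cis (Arg z)"
        by (simp add: t_def mult.commute mult.left_commute flip: cis_divide)
      then show ?thesis by (simp only: z[symmetric])
    qed
    ultimately show "z \<in> cis ` {a..<a + 2 * pi}" by blast
  qed
qed auto

text \<open>The arc of the circle from \<open>b\<close> to \<open>c\<close> meets the two segments only in its ends. Its image therefore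
  lies in the two gaps left by the image segments, and if just the second segment is reversed then it
  starts in one gap and ends in the other, although it is connected.\<close>

lemma no_single_reversal:
  fixes h :: "complex \<Rightarrow> complex"
  assumes h: "continuous_on (cball 0 1) h" "inj_on h (cball 0 1)" "h ` cball 0 1 = cball 0 1"
    and cyc: "cyclic_angles a b c d" "cyclic_angles a' b' c' d'"
    and ab: "h ` cis ` {a..b} = cis ` {a'..b'}" and cd: "h ` cis ` {c..d} = cis ` {c'..d'}"
    and ends: "h (cis a) = cis a'" "h (cis b) = cis b'" "h (cis c) = cis d'" "h (cis d) = cis c'"
  shows False
proof -
  have lt: "a < b" "b < c" "c < d" "d < a + 2 * pi" "a' < b'" "b' < c'" "c' < d'" "d' < a' + 2 * pi"
    using cyc by (auto simp: cyclic_angles_def)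
  let ?T = "h ` cis ` {b..c}" and ?U = "cis ` {b'..c'}" and ?W = "cis ` {d'..a' + 2 * pi}"
  have cisb: "cis x \<in> cball 0 1" for x by simp
  have inj: "x = y" if "h (cis x) = h (cis y)" "x \<in> {a..<a + 2 * pi}" "y \<in> {a..<a + 2 * pi}" for x y
    using inj_onD[OF inj_on_cis inj_onD[OF h(2) that(1) cisb cisb]] that(2,3) .
  have conn: "connected ?T"
    by (intro connected_continuous_image continuous_on_cis_real continuous_on_subset[OF h(1)]) auto
  have closed: "closed ?U" "closed ?W"
    by (intro compact_imp_closed compact_continuous_image continuous_on_cis_real compact_Icc)+
  \<comment> \<open>a point of the image inside a segment would have its preimage in that segment, hence at an end of it\<close>
  have sub: "?T \<subseteq> ?U \<union> ?W"
  proof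
    fix z assume "z \<in> ?T"
    then obtain x where x: "x \<in> {b..c}" "z = h (cis x)" by blast
    have "z \<in> sphere 0 1" using disc_homeo_circle[OF h] x(2) by force
    then obtain y where y: "y \<in> {a'..<a' + 2 * pi}" "z = cis y" unfolding circle_eq[of a'] by blast
    show "z \<in> ?U \<union> ?W"
    proof (rule ccontr)
      assume "z \<notin> ?U \<union> ?W"
      then have n: "y \<notin> {b'..c'}" "y \<notin> {d'..a' + 2 * pi}" using y by auto
      then have "y < b' \<or> c' < y \<and> y < d'" using y(1) by auto
      then show False
      proof
        assume yb: "y < b'"
        then have "cis y \<in> cis ` {a'..b'}" using y(1) by auto
        then have "z \<in> h ` cis ` {a..b}" by (simp only: ab y(2))
        then obtain t where t: "t \<in> {a..b}" "z = h (cis t)" by blast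
        have "t = x" by (rule inj) (use t x lt in \<open>simp_all\<close>)
        then have "x = b" using t(1) x(1) by simp
        then have "cis y = cis b'" using x(2) y(2) ends(2) by simp
        then have "y = b'" by (rule inj_onD[OF inj_on_cis[of a']]) (use y(1) lt in simp_all)
        then show False using yb by simp
      next
        assume yc: "c' < y \<and> y < d'"
        then have "cis y \<in> cis ` {c'..d'}" by auto
        then have "z \<in> h ` cis ` {c..d}" by (simp only: cd y(2))
        then obtain t where t: "t \<in> {c..d}" "z = h (cis t)" by blast
        have "t = x" by (rule inj) (use t x lt in \<open>simp_all\<close>)
        then have "x = c" using t(1) x(1) by simp
        then have "cis y = cis d'" using x(2) y(2) ends(3) by simp
        then have "y = d'" by (rule inj_onD[OF inj_on_cis[of a']]) (use y(1) lt in simp_all)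
        then show False using yc by simp
      qed
    qed
  qed
  have disj: "?U \<inter> ?W = {}"
  proof -
    have "cis x \<noteq> cis y" if "x \<in> {b'..c'}" "y \<in> {d'..a' + 2 * pi}" for x y
      using inj_onD[OF inj_on_cis[of b'], of x y] that lt by auto
    then show ?thesis by blast
  qed
  have "cis b' \<in> ?T" by (rule image_eqI[of _ _ "cis b"]) (use ends(2) lt in auto)
  moreover have "cis d' \<in> ?T" by (rule image_eqI[of _ _ "cis c"]) (use ends(3) lt in auto)
  moreover have "cis b' \<in> ?U" "cis d' \<in> ?W" using lt by auto
  ultimately have "?U \<inter> ?T \<noteq> {}" "?W \<inter> ?T \<noteq> {}" by blast+
  moreover have "?U \<inter> ?W \<inter> ?T = {}" using disj by blast
  ultimately show False
    using conn closed sub unfolding connected_closed by blast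
qed

section \<open>The two arrows of an edge\<close>

lemma disc_chart_inj: "disc_chart X D f \<Longrightarrow> inj_on f (cball 0 1)"
  by (auto simp: disc_chart_def embedding_map_def homeomorphic_map_def)

lemma disc_chart_subset_topspace: "disc_chart X D f \<Longrightarrow> D \<subseteq> topspace X"
  unfolding disc_chart_def embedding_map_def
  by (metis homeomorphic_imp_surjective_map inf_le1 topspace_euclidean_subtopology topspace_subtopology)

text \<open>Both charts are homeomorphisms onto the disc, so one followed by the inverse of the other is a
  self-homeomorphism of the closed unit disc.\<close>

lemma disc_transition:
  assumes "disc_chart X D f" "disc_chart X D f'"
  obtains h where "continuous_on (cball 0 1) h" "inj_on h (cball 0 1)" "h ` cball 0 1 = cball 0 1"
    "\<And>z. z \<in> cball 0 1 \<Longrightarrow> f z = f' (h z)"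
proof -
  let ?C = "cball (0::complex) 1"
  have f: "homeomorphic_map (top_of_set ?C) (subtopology X D) f"
    and f': "homeomorphic_map (top_of_set ?C) (subtopology X D) f'"
    using assms by (auto simp: disc_chart_def embedding_map_def)
  obtain g where g: "homeomorphic_maps (top_of_set ?C) (subtopology X D) f' g"
    using f' homeomorphic_map_maps by blast
  then have "homeomorphic_map (subtopology X D) (top_of_set ?C) g"
    using homeomorphic_maps_map by blast
  then have h: "homeomorphic_map (top_of_set ?C) (top_of_set ?C) (g \<circ> f)"
    using f homeomorphic_map_compose by blast
  show thesis
  proof
    show "continuous_on ?C (g \<circ> f)"
      using homeomorphic_imp_continuous_map[OF h] by simp
    show "inj_on (g \<circ> f) ?C"
      using homeomorphic_imp_injective_map[OF h] by simp
    show "(g \<circ> f) ` ?C = ?C"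
      using homeomorphic_imp_surjective_map[OF h] by simp
    show "f z = f' ((g \<circ> f) z)" if "z \<in> ?C" for z
    proof -
      have "f z \<in> topspace (subtopology X D)"
        using homeomorphic_imp_surjective_map[OF f] that by auto
      then show ?thesis using g by (simp add: homeomorphic_maps_def)
    qed
  qed
qed

lemma disc_chart_sphere:
  assumes "disc_chart X D f" "disc_chart X D f'"
  shows "f ` sphere 0 1 = f' ` sphere 0 1"
proof -
  obtain h where h: "continuous_on (cball 0 1) h" "inj_on h (cball 0 1)" "h ` cball 0 1 = cball 0 1"
    "\<And>z. z \<in> cball 0 1 \<Longrightarrow> f z = f' (h z)"
    using disc_transition[OF assms] by blast
  have "f ` sphere 0 1 = f' ` (h ` sphere 0 1)"
    unfolding image_image by (intro image_cong) (auto simp: h(4))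
  then show ?thesis by (simp add: disc_homeo_circle[OF h(1-3)])
qed

lemma disc_boundary_chart: "disc_chart X D f \<Longrightarrow> disc_boundary X D = f ` sphere 0 1"
  unfolding disc_boundary_def using disc_chart_sphere by blast

lemma disc_chart_cnj:
  assumes "disc_chart X D f"
  shows "disc_chart X D (f \<circ> cnj)"
proof -
  have im: "cnj ` cball 0 1 = cball 0 1"
  proof
    show "cball 0 1 \<subseteq> cnj ` cball 0 1"
    proof
      fix z :: complex assume "z \<in> cball 0 1"
      then show "z \<in> cnj ` cball 0 1" by (intro image_eqI[of _ _ "cnj z"]) auto
    qed
  qed auto
  have "homeomorphic_maps (top_of_set (cball 0 1)) (top_of_set (cball 0 1)) cnj cnj"
    by (auto simp: homeomorphic_maps_def intro: continuous_intros)
  then have "homeomorphic_map (top_of_set (cball 0 1)) (top_of_set (cball 0 1)) cnj"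
    using homeomorphic_maps_map by blast
  moreover have "(f \<circ> cnj) ` cball 0 1 = D"
    using assms by (simp only: image_comp[symmetric] im disc_chart_def)
  moreover have "homeomorphic_map (top_of_set (cball 0 1)) (subtopology X D) f"
    using assms by (auto simp: disc_chart_def embedding_map_def)
  ultimately show ?thesis
    by (simp add: disc_chart_def embedding_map_def homeomorphic_map_compose)
qed

text \<open>The condition that \<open>presents\<close> imposes on the arrows of one edge, with the chart and the four angles
  exposed so that symmetries can be stated in terms of them.\<close>

definition arrows_at ::
  "'a ribbon_graph \<Rightarrow> 'a set \<Rightarrow> (complex \<Rightarrow> 'a) \<Rightarrow> real \<Rightarrow> real \<Rightarrow> real \<Rightarrow> real \<Rightarrow>
     (arrow \<times> tip \<Rightarrow> 'a) \<Rightarrow> bool" where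
  "arrows_at G D f a b c d p \<longleftrightarrow>
     disc_chart (surface G) D f \<and> cyclic_angles a b c d \<and>
     f ` cis ` {a..b} \<in> segments G \<and> f ` cis ` {c..d} \<in> segments G \<and>
     p (ArrA, Tail) = f (cis a) \<and> p (ArrA, Head) = f (cis b) \<and>
     p (ArrB, Tail) = f (cis c) \<and> p (ArrB, Head) = f (cis d)"

definition edge_arrows :: "'a ribbon_graph \<Rightarrow> 'a set \<Rightarrow> (arrow \<times> tip \<Rightarrow> 'a) \<Rightarrow> bool" where
  "edge_arrows G D p \<longleftrightarrow> (\<exists>f a b c d. arrows_at G D f a b c d p)"

text \<open>The angles may start at any point of the circle, so the second segment can be taken first if the
  former first segment is moved on by a full turn.\<close>

lemma arrows_at_swap:
  assumes "arrows_at G D f a b c d p"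
  shows "arrows_at G D f c d (a + 2 * pi) (b + 2 * pi) (p \<circ> swap_arrows)"
  using assms unfolding arrows_at_def cis_shift cis_full_turn
  by (auto simp: cyclic_angles_def swap_arrows_def)

lemma cnj_cis_image: "(f \<circ> cnj) ` cis ` {- y..- x} = f ` cis ` {x..y}"
proof -
  have "{- y..- x} = uminus ` {x..y}" by simp
  then show ?thesis by (simp only: image_image) (simp add: cis_cnj)
qed

text \<open>Mirroring the chart reverses the boundary orientation and with it both arrows; the
  segments keep their names because the second one is shifted by a full turn.\<close>

lemma arrows_at_reverse:
  assumes "arrows_at G D f a b c d p"
  shows "arrows_at G D (f \<circ> cnj) (- b) (- a) (- d + 2 * pi) (- c + 2 * pi) (p \<circ> reverse_arrows)"
  using assms unfolding arrows_at_def cis_shift cis_full_turn cnj_cis_image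
  by (auto simp: cyclic_angles_def reverse_arrows_def disc_chart_cnj cis_cnj)

lemma edge_arrows_turn:
  assumes "edge_arrows G D p" "k \<in> turns"
  shows "edge_arrows G D (p \<circ> k)"
proof -
  have swap: "edge_arrows G D (q \<circ> swap_arrows)" if "edge_arrows G D q" for q
    using that arrows_at_swap unfolding edge_arrows_def by blast
  have reverse: "edge_arrows G D (q \<circ> reverse_arrows)" if "edge_arrows G D q" for q
    using that arrows_at_reverse unfolding edge_arrows_def by blast
  from assms(2) show ?thesis
    by (rule turns_cases) (simp_all add: assms(1) swap reverse flip: comp_assoc)
qed

text \<open>Each segment has its ends either kept or exchanged. The cases in which
  only one segment has its ends exchanged are excluded by \<open>no_single_reversal\<close>.\<close>

lemma arrows_at_same_segments:
  assumes p: "arrows_at G D f a b c d p" and q: "arrows_at G D f' a' b' c' d' q"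
    and A: "f ` cis ` {a..b} = f' ` cis ` {a'..b'}" and B: "f ` cis ` {c..d} = f' ` cis ` {c'..d'}"
  shows "q = p \<or> q = p \<circ> reverse_arrows"
proof -
  have f: "disc_chart (surface G) D f" and f': "disc_chart (surface G) D f'"
    and cyc: "cyclic_angles a b c d" and cyc': "cyclic_angles a' b' c' d'"
    using p q by (auto simp: arrows_at_def)
  obtain h where h: "continuous_on (cball 0 1) h" "inj_on h (cball 0 1)" "h ` cball 0 1 = cball 0 1"
    "\<And>z. z \<in> cball 0 1 \<Longrightarrow> f z = f' (h z)"
    using disc_transition[OF f f'] by blast
  have fh: "f (cis x) = f' (h (cis x))" for x by (simp add: h(4))
  have arc: "h ` cis ` {x..y} = cis ` {x'..y'}"
    if "f ` cis ` {x..y} = f' ` cis ` {x'..y'}" for x y x' y'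
  proof -
    have "f' ` (h ` cis ` {x..y}) = f' ` (cis ` {x'..y'})"
      using that by (simp add: image_image fh)
    moreover have "h ` cis ` {x..y} \<subseteq> cball 0 1" using h(3) by force
    moreover have "cis ` {x'..y'} \<subseteq> cball 0 1" by auto
    ultimately show ?thesis
      by (rule iffD1[OF inj_on_image_eq_iff[OF disc_chart_inj[OF f']], rotated 2])
  qed
  note A' = arc[OF A] and B' = arc[OF B]
  have ends: "h (cis x) = cis x' \<and> h (cis y) = cis y' \<or> h (cis x) = cis y' \<and> h (cis y) = cis x'"
    if "h ` cis ` {x..y} = cis ` {x'..y'}" "x < y" "y < x + 2 * pi" "x' < y'" "y' < x' + 2 * pi"
    for x y x' y'
  proof -
    have inj: "inj_on cis {x..y}" "inj_on cis {x'..y'}"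
      by (rule inj_on_subset[OF inj_on_cis]; use that in auto)+
    have "inj_on h (cis ` {x..y})" by (rule inj_on_subset[OF h(2)]) auto
    then have "inj_on (h \<circ> cis) {x..y}" using inj(1) comp_inj_on by blast
    moreover have "continuous_on {x..y} (h \<circ> cis)"
      by (intro continuous_on_compose continuous_on_cis_real continuous_on_subset[OF h(1)]) auto
    ultimately show ?thesis
      using arc_endpoints[of x y x' y' "h \<circ> cis" cis] that inj(2) continuous_on_cis_real
      by (auto simp: image_comp)
  qed
  have endsA: "h (cis a) = cis a' \<and> h (cis b) = cis b' \<or> h (cis a) = cis b' \<and> h (cis b) = cis a'"
    by (rule ends[OF A']) (use cyc cyc' in \<open>auto simp: cyclic_angles_def\<close>)
  have endsB: "h (cis c) = cis c' \<and> h (cis d) = cis d' \<or> h (cis c) = cis d' \<and> h (cis d) = cis c'"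
    by (rule ends[OF B']) (use cyc cyc' in \<open>auto simp: cyclic_angles_def\<close>)
  have "\<not> (h (cis a) = cis a' \<and> h (cis b) = cis b' \<and> h (cis c) = cis d' \<and> h (cis d) = cis c')"
    using no_single_reversal[OF h(1-3) cyc cyc' A' B'] by blast
  moreover have "\<not> (h (cis a) = cis b' \<and> h (cis b) = cis a' \<and> h (cis c) = cis c' \<and> h (cis d) = cis d')"
    \<comment> \<open>the same lemma with the first segment, moved on by a full turn, in second place\<close>
    using no_single_reversal[OF h(1-3), of c d "a + 2 * pi" "b + 2 * pi"
        c' d' "a' + 2 * pi" "b' + 2 * pi"] cyc cyc' A' B'
    by (auto simp: cyclic_angles_def cis_shift cis_full_turn)
  ultimately consider
    "h (cis a) = cis a'" "h (cis b) = cis b'" "h (cis c) = cis c'" "h (cis d) = cis d'" |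
    "h (cis a) = cis b'" "h (cis b) = cis a'" "h (cis c) = cis d'" "h (cis d) = cis c'"
    using endsA endsB by blast
  then show ?thesis
  proof cases
    case 1
    then have "q = p"
      using p q by (intro arrow_tip_fun_eqI) (simp_all add: arrows_at_def fh)
    then show ?thesis ..
  next
    case 2
    then have "q = p \<circ> reverse_arrows"
      using p q by (intro arrow_tip_fun_eqI) (simp_all add: arrows_at_def fh reverse_arrows_def)
    then show ?thesis ..
  qed
qed

text \<open>An edge contains only two segments, so two descriptions of its arrows use the same segments,
  possibly in the other order.\<close>

lemma edge_arrows_unique:
  assumes two: "card {s \<in> segments G. s \<subseteq> D} = 2"
    and p: "edge_arrows G D p" and q: "edge_arrows G D q"
  shows "\<exists>k \<in> turns. q = p \<circ> k"
proof -
  have both: "{s \<in> segments G. s \<subseteq> D} = {f ` cis ` {a..b}, f ` cis ` {c..d}}"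
    if "arrows_at G D f a b c d r" for f a b c d r
  proof -
    have f: "disc_chart (surface G) D f" and lt: "a < b" "b < c" "c < d" "d < a + 2 * pi"
      and seg: "f ` cis ` {a..b} \<in> segments G" "f ` cis ` {c..d} \<in> segments G"
      using that by (auto simp: arrows_at_def cyclic_angles_def)
    have "f (cis a) \<notin> f ` cis ` {c..d}"
    proof
      assume "f (cis a) \<in> f ` cis ` {c..d}"
      then obtain x where x: "x \<in> {c..d}" "f (cis a) = f (cis x)" by blast
      then have "cis a = cis x" using disc_chart_inj[OF f] by (auto dest!: inj_onD)
      then have "a = x" using inj_onD[OF inj_on_cis[of a], of a x] x(1) lt by auto
      then show False using x(1) lt by auto
    qed
    moreover have "f (cis a) \<in> f ` cis ` {a..b}" using lt by auto
    ultimately have "f ` cis ` {a..b} \<noteq> f ` cis ` {c..d}" by metis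
    then have "card {f ` cis ` {a..b}, f ` cis ` {c..d}} = 2" by simp
    moreover have "{f ` cis ` {a..b}, f ` cis ` {c..d}} \<subseteq> {s \<in> segments G. s \<subseteq> D}"
    proof -
      have "cis ` {x..y} \<subseteq> cball 0 1" for x y by auto
      then have "f ` cis ` {x..y} \<subseteq> D" for x y
        using f image_mono[of "cis ` {x..y}" "cball 0 1" f] by (simp add: disc_chart_def)
      then show ?thesis using seg by simp
    qed
    moreover have "finite {s \<in> segments G. s \<subseteq> D}"
      by (rule card_ge_0_finite) (simp add: two)
    ultimately show ?thesis
      using card_subset_eq[of "{s \<in> segments G. s \<subseteq> D}" "{f ` cis ` {a..b}, f ` cis ` {c..d}}"]
        two by simp
  qed
  obtain f a b c d where P: "arrows_at G D f a b c d p" using p unfolding edge_arrows_def by blast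
  obtain f' a' b' c' d' where Q: "arrows_at G D f' a' b' c' d' q"
    using q unfolding edge_arrows_def by blast
  consider "f ` cis ` {a..b} = f' ` cis ` {a'..b'}" "f ` cis ` {c..d} = f' ` cis ` {c'..d'}" |
    "f ` cis ` {c..d} = f' ` cis ` {a'..b'}" "f ` cis ` {a..b} = f' ` cis ` {c'..d'}"
    using both[OF P] unfolding both[OF Q] doubleton_eq_iff by argo
  then show ?thesis
  proof cases
    case 1
    then have "q = p \<circ> id \<or> q = p \<circ> reverse_arrows"
      using arrows_at_same_segments[OF P Q] by simp
    then show ?thesis by (auto simp: turns_def)
  next
    case 2
    then have "q = p \<circ> swap_arrows \<or> q = p \<circ> swap_arrows \<circ> reverse_arrows"
      using arrows_at_same_segments[OF arrows_at_swap[OF P] Q] by (simp add: cis_shift)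
    then show ?thesis by (auto simp: turns_def comp_assoc)
  qed
qed

section \<open>Arrow presentations of a ribbon graph\<close>

definition free_arc :: "'a ribbon_graph \<Rightarrow> 'a \<Rightarrow> 'a \<Rightarrow> bool" where
  "free_arc G x y \<longleftrightarrow>
     (\<exists>v \<in> verts G. \<exists>S \<subseteq> disc_boundary (surface G) v.
        arc_between (surface G) S x y \<and> S \<inter> attachment G = {x, y})"

definition free_arc_pairs :: "nat \<Rightarrow> 'a ribbon_graph \<Rightarrow> (arrow_end \<Rightarrow> 'a) \<Rightarrow> arrow_end set set" where
  "free_arc_pairs n G pos =
     {{p, q} | p q. p \<in> {1..n} \<times> UNIV \<and> q \<in> {1..n} \<times> UNIV \<and> free_arc G (pos p) (pos q)}"

definition bare_verts :: "'a ribbon_graph \<Rightarrow> 'a set set" where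
  "bare_verts G = {v \<in> verts G. \<forall>s \<in> segments G. \<not> s \<subseteq> v}"

text \<open>A presentation together with the positions of its arrow ends, which are needed to
  compare and transport presentations.\<close>

definition presents_at ::
  "nat \<Rightarrow> arrow_presentation \<Rightarrow> 'a ribbon_graph \<Rightarrow> (nat \<Rightarrow> 'a set) \<Rightarrow> (arrow_end \<Rightarrow> 'a) \<Rightarrow> bool" where
  "presents_at n P G l pos \<longleftrightarrow>
     (\<forall>i \<in> {1..n}. edge_arrows G (l i) (\<lambda>x. pos (i, x))) \<and>
     free_arcs P = free_arc_pairs n G pos \<and> bare_circles P = card (bare_verts G)"

lemma presents_iff: "presents n P G l \<longleftrightarrow> (\<exists>pos. presents_at n P G l pos)"
  unfolding presents_def presents_at_def edge_arrows_def arrows_at_def cyclic_angles_def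
    free_arc_pairs_def free_arc_def bare_verts_def image_image
  by (simp only: conj_assoc)

text \<open>Renamings that agree on the labels in \<open>{1..n}\<close> therefore act in the same way on \<open>P\<close>.\<close>

lemma presents_labels: "presents n P G l \<Longrightarrow> c \<in> free_arcs P \<Longrightarrow> c \<subseteq> {1..n} \<times> UNIV"
  by (auto simp: presents_iff presents_at_def free_arc_pairs_def)

lemma free_arc_pairs_cong:
  assumes "\<And>p. p \<in> {1..n} \<times> UNIV \<Longrightarrow> pos p = pos' p"
  shows "free_arc_pairs n G pos = free_arc_pairs n G pos'"
  unfolding free_arc_pairs_def using assms by (intro Collect_cong) metis

lemma free_arc_pairs_relabel:
  assumes "\<And>i. \<sigma> i \<in> turns"
  shows "free_arc_pairs n G (\<lambda>(i, x). pos (i, \<sigma> i x)) = relabel_arc \<sigma> ` free_arc_pairs n G pos"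
    (is "?L = ?R")
proof -
  have pair: "relabel_arc \<sigma> {(i, x), (j, y)} = {(i, \<sigma> i x), (j, \<sigma> j y)}" for i j x y
    by (simp add: relabel_arc_def)
  have L: "?L = {{(i, x), (j, y)} | i x j y. i \<in> {1..n} \<and> j \<in> {1..n} \<and>
        free_arc G (pos (i, \<sigma> i x)) (pos (j, \<sigma> j y))}"
    unfolding free_arc_pairs_def by auto
  have R: "free_arc_pairs n G pos = {{(i, x), (j, y)} | i x j y. i \<in> {1..n} \<and> j \<in> {1..n} \<and>
        free_arc G (pos (i, x)) (pos (j, y))}"
    unfolding free_arc_pairs_def by auto
  show ?thesis
  proof
    show "?L \<subseteq> ?R"
    proof
      fix c assume "c \<in> ?L"
      then obtain i x j y where c: "c = {(i, x), (j, y)}" "i \<in> {1..n}" "j \<in> {1..n}"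
        "free_arc G (pos (i, \<sigma> i x)) (pos (j, \<sigma> j y))" unfolding L by blast
      have "c = relabel_arc \<sigma> {(i, \<sigma> i x), (j, \<sigma> j y)}"
        by (simp add: pair c(1) turns_involution_apply assms)
      moreover have "{(i, \<sigma> i x), (j, \<sigma> j y)} \<in> free_arc_pairs n G pos"
        unfolding R using c(2-4) by blast
      ultimately show "c \<in> ?R" by blast
    qed
    show "?R \<subseteq> ?L"
    proof
      fix c assume "c \<in> ?R"
      then obtain i x j y where c: "c = relabel_arc \<sigma> {(i, x), (j, y)}" "i \<in> {1..n}" "j \<in> {1..n}"
        "free_arc G (pos (i, x)) (pos (j, y))" unfolding R by blast
      have "free_arc G (pos (i, \<sigma> i (\<sigma> i x))) (pos (j, \<sigma> j (\<sigma> j y)))"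
        using c(4) by (simp add: turns_involution_apply assms)
      then show "c \<in> ?L" unfolding L c(1) pair using c(2,3) by blast
    qed
  qed
qed

lemma presents_turn_equiv:
  assumes "presents n P G l" "turn_equiv P Q"
  shows "presents n Q G l"
proof -
  obtain pos where pos: "presents_at n P G l pos" using assms(1) presents_iff by blast
  obtain \<sigma> where s: "\<And>i. \<sigma> i \<in> turns" "Q = relabel \<sigma> P"
    using assms(2) by (auto simp: turn_equiv_def)
  have "edge_arrows G (l i) (\<lambda>x. pos (i, \<sigma> i x))" if "i \<in> {1..n}" for i
  proof -
    have "edge_arrows G (l i) (\<lambda>x. pos (i, x))" using pos that unfolding presents_at_def by blast
    from edge_arrows_turn[OF this s(1)[of i]] show ?thesis by (simp only: comp_def)
  qed
  moreover have "free_arcs Q = free_arc_pairs n G (\<lambda>(i, x). pos (i, \<sigma> i x))"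
    "bare_circles Q = card (bare_verts G)"
    using pos free_arc_pairs_relabel[OF s(1), of n G pos]
    by (simp_all add: s(2) presents_at_def relabel_def)
  ultimately have "presents_at n Q G l (\<lambda>(i, x). pos (i, \<sigma> i x))"
    unfolding presents_at_def by simp
  then show ?thesis using presents_iff by blast
qed

lemma ordered_graphs_edge: "(G, l) \<in> ordered_graphs n \<Longrightarrow> i \<in> {1..n} \<Longrightarrow> l i \<in> edges G"
  using bij_betwE unfolding ordered_graphs_def by fast

lemma presents_unique:
  assumes G: "(G, l) \<in> ordered_graphs n" and P: "presents n P G l" and Q: "presents n Q G l"
  shows "turn_equiv P Q"
proof -
  obtain p where p: "presents_at n P G l p" using P presents_iff by blast
  obtain q where q: "presents_at n Q G l q" using Q presents_iff by blast
  have "\<exists>k \<in> turns. i \<in> {1..n} \<longrightarrow> (\<lambda>x. q (i, x)) = (\<lambda>x. p (i, x)) \<circ> k" for i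
  proof (cases "i \<in> {1..n}")
    case True
    then have "l i \<in> edges G" by (rule ordered_graphs_edge[OF G])
    then have "card {s \<in> segments G. s \<subseteq> l i} = 2"
      using G by (auto simp: ordered_graphs_def ribbon_graph_def)
    then show ?thesis
      using edge_arrows_unique p q True unfolding presents_at_def by blast
  next
    case False
    then show ?thesis using id_in_turns by blast
  qed
  then obtain \<sigma> where s: "\<And>i. \<sigma> i \<in> turns"
    "\<And>i. i \<in> {1..n} \<Longrightarrow> (\<lambda>x. q (i, x)) = (\<lambda>x. p (i, x)) \<circ> \<sigma> i"
    by metis
  have "q (i, x) = p (i, \<sigma> i x)" if "i \<in> {1..n}" for i x
    using fun_cong[OF s(2)[OF that], of x] by simp
  then have "free_arc_pairs n G q = free_arc_pairs n G (\<lambda>(i, x). p (i, \<sigma> i x))"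
    by (intro free_arc_pairs_cong) auto
  then have "free_arcs Q = relabel_arc \<sigma> ` free_arcs P" "bare_circles Q = bare_circles P"
    using p q free_arc_pairs_relabel[OF s(1), of n G p] by (simp_all add: presents_at_def)
  then have "Q = relabel \<sigma> P" by (simp add: relabel_def)
  then show ?thesis using s(1) by (auto simp: turn_equiv_def)
qed

section \<open>Isomorphisms carry presentations along\<close>

definition ribbon_iso :: "('a \<Rightarrow> 'b) \<Rightarrow> 'a ribbon_graph \<Rightarrow> 'b ribbon_graph \<Rightarrow> bool" where
  "ribbon_iso f G H \<longleftrightarrow> homeomorphic_map (surface G) (surface H) f \<and>
     image f ` verts G = verts H \<and> image f ` edges G = edges H"

lemma ribbon_graph_subset_topspace:
  assumes "ribbon_graph G"
  shows "D \<in> verts G \<union> edges G \<Longrightarrow> D \<subseteq> topspace (surface G)"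
  using assms by (auto simp: ribbon_graph_def)

lemma ribbon_iso_homeomorphic: "ribbon_iso f G H \<Longrightarrow> homeomorphic_map (surface G) (surface H) f"
  by (simp add: ribbon_iso_def)

lemma ribbon_iso_inj: "ribbon_iso f G H \<Longrightarrow> inj_on f (topspace (surface G))"
  by (rule homeomorphic_imp_injective_map[OF ribbon_iso_homeomorphic])

lemma ribbon_iso_inverse:
  assumes G: "ribbon_graph G" and f: "ribbon_iso f G H"
  obtains g where "ribbon_iso g H G" "\<And>x. x \<in> topspace (surface G) \<Longrightarrow> g (f x) = x"
proof -
  obtain g where g: "homeomorphic_maps (surface G) (surface H) f g"
    using ribbon_iso_homeomorphic[OF f] homeomorphic_map_maps by blast
  then have gf: "g (f x) = x" if "x \<in> topspace (surface G)" for x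
    using that by (simp add: homeomorphic_maps_def)
  then have im: "g ` f ` D = D" if "D \<subseteq> topspace (surface G)" for D
    using that by (force simp: image_iff subset_iff)
  have fam: "image g ` image f ` \<D> = \<D>" if "\<D> \<subseteq> verts G \<union> edges G" for \<D>
  proof -
    have "g ` f ` D = D" if "D \<in> \<D>" for D
      using im ribbon_graph_subset_topspace[OF G] \<open>\<D> \<subseteq> _\<close> that by blast
    then show ?thesis unfolding image_image[of "image g"] by simp
  qed
  have "ribbon_iso g H G"
    unfolding ribbon_iso_def
  proof (intro conjI)
    show "homeomorphic_map (surface H) (surface G) g"
      using g homeomorphic_maps_map by blast
    show "image g ` verts H = verts G" "image g ` edges H = edges G"
      using f fam[of "verts G"] fam[of "edges G"] by (simp_all add: ribbon_iso_def)
  qed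
  then show thesis using gf that by blast
qed

lemma ribbon_iso_attachment:
  assumes G: "ribbon_graph G" and f: "ribbon_iso f G H"
  shows "f ` attachment G = attachment H"
proof -
  have "\<Union> (verts G) \<subseteq> topspace (surface G)" "\<Union> (edges G) \<subseteq> topspace (surface G)"
    using G by (auto simp: ribbon_graph_def)
  then have "f ` attachment G = f ` \<Union> (verts G) \<inter> f ` \<Union> (edges G)"
    unfolding attachment_def by (rule inj_on_image_Int[OF ribbon_iso_inj[OF f]])
  also have "\<dots> = attachment H"
    using f by (simp add: attachment_def ribbon_iso_def image_Union)
  finally show ?thesis .
qed

lemma attachment_subset_topspace: "ribbon_graph G \<Longrightarrow> attachment G \<subseteq> topspace (surface G)"
  by (auto simp: attachment_def ribbon_graph_def)

lemma ribbon_iso_segments: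
  assumes G: "ribbon_graph G" and f: "ribbon_iso f G H"
  shows "segments H = image f ` segments G"
proof -
  note hom = ribbon_iso_homeomorphic[OF f]
  have G_att: "topspace (surface G) \<inter> attachment G = attachment G"
    using attachment_subset_topspace[OF G] by blast
  have "f ` attachment G \<subseteq> topspace (surface H)"
    using image_mono[OF attachment_subset_topspace[OF G], of f]
    by (simp only: homeomorphic_imp_surjective_map[OF hom])
  then have "topspace (surface H) \<inter> attachment H = attachment H"
    using ribbon_iso_attachment[OF G f] by blast
  with G_att have "f ` (topspace (surface G) \<inter> attachment G) = topspace (surface H) \<inter> attachment H"
    by (simp only: ribbon_iso_attachment[OF G f])
  then show ?thesis
    unfolding segments_def
    by (intro homeomorphic_map_connected_components_of homeomorphic_map_subtopologies[OF hom])
qed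

lemma segments_subset_topspace: "s \<in> segments G \<Longrightarrow> s \<subseteq> topspace (surface G)"
  unfolding segments_def using connected_components_of_subset by fastforce

lemma embedding_map_homeomorphic:
  assumes "homeomorphic_map X Y f" "embedding_map Z X g"
  shows "embedding_map Z Y (f \<circ> g)"
  using assms embedding_map_compose surjective_embedding_map by blast

lemma disc_chart_homeomorphic:
  assumes "homeomorphic_map X Y f" "disc_chart X D g"
  shows "disc_chart Y (f ` D) (f \<circ> g)"
  using assms embedding_map_homeomorphic by (auto simp: disc_chart_def)

lemma ribbon_iso_arrows:
  assumes G: "ribbon_graph G" and f: "ribbon_iso f G H" and p: "edge_arrows G D p"
  shows "edge_arrows H (f ` D) (f \<circ> p)"
proof -
  obtain g a b c d where g: "arrows_at G D g a b c d p" using p unfolding edge_arrows_def by blast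
  have "disc_chart (surface H) (f ` D) (f \<circ> g)"
    using disc_chart_homeomorphic[OF ribbon_iso_homeomorphic[OF f]] g by (simp add: arrows_at_def)
  moreover have "(f \<circ> g) ` cis ` A = f ` (g ` cis ` A)" for A by (simp only: image_comp comp_assoc)
  then have "(f \<circ> g) ` cis ` A \<in> segments H" if "g ` cis ` A \<in> segments G" for A
    using that unfolding ribbon_iso_segments[OF G f] by (simp only: imageI)
  ultimately have "arrows_at H (f ` D) (f \<circ> g) a b c d (f \<circ> p)"
    using g unfolding arrows_at_def comp_apply by (simp del: comp_apply)
  then show ?thesis unfolding edge_arrows_def by blast
qed

lemma ribbon_iso_free_arc:
  assumes G: "ribbon_graph G" and f: "ribbon_iso f G H" and arc: "free_arc G x y"
  shows "free_arc H (f x) (f y)"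
proof -
  note hom = ribbon_iso_homeomorphic[OF f]
  obtain v S where v: "v \<in> verts G" and S: "S \<subseteq> disc_boundary (surface G) v"
    "arc_between (surface G) S x y" "S \<inter> attachment G = {x, y}"
    using arc unfolding free_arc_def by blast
  have "is_disc (surface G) v" using G v by (simp add: ribbon_graph_def)
  then obtain g where g: "disc_chart (surface G) v g" unfolding is_disc_def by blast
  have "f ` S \<subseteq> disc_boundary (surface H) (f ` v)"
    using image_mono[OF S(1), of f]
    by (simp add: disc_boundary_chart[OF g] image_comp
        disc_boundary_chart[OF disc_chart_homeomorphic[OF hom g]])
  moreover have "arc_between (surface H) (f ` S) (f x) (f y)"
  proof -
    obtain u :: "real \<Rightarrow> 'a" where u: "embedding_map (top_of_set {0..1}) (surface G) u"
      "u ` {0..1} = S" "u 0 = x" "u 1 = y"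
      using S(2) unfolding arc_between_def by blast
    then show ?thesis
      unfolding arc_between_def using embedding_map_homeomorphic[OF hom u(1)]
      by (intro exI[of _ "f \<circ> u"]) (auto simp flip: image_comp)
  qed
  moreover have "f ` S \<inter> attachment H = {f x, f y}"
  proof -
    have "S \<subseteq> topspace (surface G)"
    proof -
      have "g ` sphere 0 1 \<subseteq> v" using g unfolding disc_chart_def by force
      then show ?thesis
        using S(1) disc_chart_subset_topspace[OF g] by (simp add: disc_boundary_chart[OF g])
    qed
    then have "f ` S \<inter> f ` attachment G = f ` (S \<inter> attachment G)"
      using inj_on_image_Int[OF ribbon_iso_inj[OF f]] attachment_subset_topspace[OF G] by blast
    then show ?thesis by (simp add: S(3) ribbon_iso_attachment[OF G f])
  qed
  moreover have "f ` v \<in> verts H" using f v by (auto simp: ribbon_iso_def)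
  ultimately show ?thesis unfolding free_arc_def by blast
qed

lemma ribbon_iso_bare_verts:
  assumes G: "ribbon_graph G" and f: "ribbon_iso f G H"
  shows "card (bare_verts H) = card (bare_verts G)"
proof -
  have sub: "f ` s \<subseteq> f ` v \<longleftrightarrow> s \<subseteq> v" if "v \<in> verts G" "s \<in> segments G" for v s
    using inj_on_image_subset_iff[OF ribbon_iso_inj[OF f]] that(1)
      ribbon_graph_subset_topspace[OF G] segments_subset_topspace[OF that(2)] by blast
  have "bare_verts H = image f ` bare_verts G"
  proof -
    have "verts H = image f ` verts G" using f by (simp add: ribbon_iso_def)
    then show ?thesis
      unfolding bare_verts_def ribbon_iso_segments[OF G f] using sub by auto
  qed
  moreover have "inj_on (image f) (bare_verts G)"
    by (rule inj_on_subset[OF inj_on_image_Pow[OF ribbon_iso_inj[OF f]]])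
      (use ribbon_graph_subset_topspace[OF G] in \<open>auto simp: bare_verts_def\<close>)
  ultimately show ?thesis by (simp add: card_image)
qed

lemma edge_arrows_subset_topspace: "edge_arrows G D p \<Longrightarrow> p x \<in> topspace (surface G)"
proof -
  assume "edge_arrows G D p"
  then obtain f a b c d where f: "arrows_at G D f a b c d p" unfolding edge_arrows_def by blast
  then have "disc_chart (surface G) D f" by (simp add: arrows_at_def)
  then have "f (cis t) \<in> topspace (surface G)" for t
    using disc_chart_subset_topspace unfolding disc_chart_def by fastforce
  moreover obtain a t where "x = (a, t)" by (cases x)
  ultimately show ?thesis using f by (cases a; cases t) (auto simp: arrows_at_def)
qed

lemma ordered_iso_iff:
  "((G, l), (H, m)) \<in> ordered_iso n \<longleftrightarrow> (G, l) \<in> ordered_graphs n \<and> (H, m) \<in> ordered_graphs n \<and>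
     (\<exists>f. ribbon_iso f G H \<and> (\<forall>i \<in> {1..n}. f ` l i = m i))"
  by (simp add: ordered_iso_def ribbon_iso_def conj_assoc)

text \<open>Everything in the definition of a presentation is topological: compose charts and positions with
  the homeomorphism. The inverse homeomorphism is needed to see that no new arrow-free arcs arise.\<close>

lemma presents_iso:
  assumes iso: "((G, l), (H, m)) \<in> ordered_iso n" and P: "presents n P G l"
  shows "presents n P H m"
proof -
  obtain f where G: "ribbon_graph G" and f: "ribbon_iso f G H"
    and m: "\<And>i. i \<in> {1..n} \<Longrightarrow> m i = f ` l i" and H: "ribbon_graph H"
    using iso unfolding ordered_iso_iff ordered_graphs_def by force
  obtain g where g: "ribbon_iso g H G" "\<And>x. x \<in> topspace (surface G) \<Longrightarrow> g (f x) = x"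
    using ribbon_iso_inverse[OF G f] by blast
  obtain pos where pos: "presents_at n P G l pos" using P presents_iff by blast
  have in_top: "pos p \<in> topspace (surface G)" if "p \<in> {1..n} \<times> UNIV" for p
    using pos that edge_arrows_subset_topspace[where p = "\<lambda>x. pos (fst p, x)" and x = "snd p"]
    by (auto simp: presents_at_def)
  have arc: "free_arc H (f (pos p)) (f (pos q)) \<longleftrightarrow> free_arc G (pos p) (pos q)"
    if "p \<in> {1..n} \<times> UNIV" "q \<in> {1..n} \<times> UNIV" for p q
    using ribbon_iso_free_arc[OF G f, of "pos p" "pos q"]
      ribbon_iso_free_arc[OF H g(1), of "f (pos p)" "f (pos q)"]
    unfolding g(2)[OF in_top[OF that(1)]] g(2)[OF in_top[OF that(2)]] by blast
  have "free_arc_pairs n H (f \<circ> pos) = free_arc_pairs n G pos"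
    unfolding free_arc_pairs_def comp_def using arc by blast
  moreover have "edge_arrows H (m i) (\<lambda>x. (f \<circ> pos) (i, x))" if "i \<in> {1..n}" for i
    using ribbon_iso_arrows[OF G f, of "l i" "\<lambda>x. pos (i, x)"] pos that
    by (simp add: m presents_at_def comp_def)
  ultimately have "presents_at n P H m (f \<circ> pos)"
    using pos by (simp add: presents_at_def ribbon_iso_bare_verts[OF G f])
  then show ?thesis using presents_iff by blast
qed

lemma ordered_iso_sym:
  assumes "((G, l), (H, m)) \<in> ordered_iso n"
  shows "((H, m), (G, l)) \<in> ordered_iso n"
proof -
  obtain f where GH: "(G, l) \<in> ordered_graphs n" "(H, m) \<in> ordered_graphs n"
    and f: "ribbon_iso f G H" and m: "\<And>i. i \<in> {1..n} \<Longrightarrow> f ` l i = m i"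
    using assms unfolding ordered_iso_iff by blast
  have G: "ribbon_graph G" using GH(1) by (simp add: ordered_graphs_def)
  obtain g where g: "ribbon_iso g H G" "\<And>x. x \<in> topspace (surface G) \<Longrightarrow> g (f x) = x"
    using ribbon_iso_inverse[OF G f] by blast
  have "g ` m i = l i" if "i \<in> {1..n}" for i
  proof -
    have "l i \<subseteq> topspace (surface G)"
      using ordered_graphs_edge[OF GH(1) that] ribbon_graph_subset_topspace[OF G] by blast
    then have "g ` f ` l i = l i" using g(2) by (force simp: image_iff subset_iff)
    then show ?thesis using m[OF that] by simp
  qed
  then show ?thesis using GH g(1) unfolding ordered_iso_iff by blast
qed

lemma presents_iso_class:
  assumes "(G, l) \<in> iso_class n H m" "(G', l') \<in> iso_class n H m" "presents n P G l"
  shows "presents n P G' l'"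
  using assms presents_iso ordered_iso_sym unfolding iso_class_def by blast

section \<open>The action\<close>

text \<open>Another presentation of the same graph, or other words for the same operation, change the result
  only by turns.\<close>

lemma ribbon_change_iff:
  assumes G: "(G, l) \<in> ordered_graphs n" and P: "presents n P G l"
    and w: "\<And>i. i \<in> {1..n} \<Longrightarrow> op_of_word (w i) = \<gamma> i"
  shows "ribbon_change n \<gamma> G l G' l' \<longleftrightarrow> presents n (apply_words w P) G' l'"
proof
  assume "ribbon_change n \<gamma> G l G' l'"
  then obtain Q u where Q: "presents n Q G l" "\<And>i. i \<in> {1..n} \<Longrightarrow> op_of_word (u i) = \<gamma> i"
    "presents n (apply_words u Q) G' l'" unfolding ribbon_change_def by blast
  have "turn_equiv (apply_words u Q) (apply_words u P)"
    by (rule apply_words_turn_equiv[OF presents_unique[OF G Q(1) P]])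
  moreover have "turn_equiv (apply_words u P) (apply_words w P)"
    by (rule apply_words_cong[OF presents_labels[OF P]]) (simp_all add: w Q(2))
  ultimately show "presents n (apply_words w P) G' l'"
    using presents_turn_equiv[OF Q(3)] turn_equiv_trans by blast
next
  assume "presents n (apply_words w P) G' l'"
  then show "ribbon_change n \<gamma> G l G' l'"
    unfolding ribbon_change_def using P w by blast
qed

lemma mem_act_id:
  "(G', l') \<in> act n (\<gamma>, id) C \<longleftrightarrow>
     (G', l') \<in> ordered_graphs n \<and> (\<exists>G l. (G, l) \<in> C \<and> ribbon_change n \<gamma> G l G' l')"
  unfolding act_def by (auto simp: comp_id)

lemma op_of_word_surj: "\<exists>w. op_of_word w = x"
  by transfer (use word_eq_refl in blast)

lemma op_of_word_append: "op_of_word (u @ v) = op_mult (op_of_word u) (op_of_word v)"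
  by transfer (rule word_eq_refl)

lemma op_of_word_Nil: "op_of_word [] = op_one"
  by transfer (rule word_eq_refl)

text \<open>That \<open>\<gamma>\<close> fixes the class says that \<open>G\<close> arises from some member of its class; this
  member is isomorphic to \<open>G\<close>, hence presented by the same \<open>P\<close>, on which the change can be decided.\<close>

lemma self_presentation:
  assumes self: "canonically_self n \<gamma> (iso_class n H m)"
    and G: "(G, l) \<in> iso_class n H m" and P: "presents n P G l"
    and w: "\<And>i. i \<in> {1..n} \<Longrightarrow> op_of_word (w i) = \<gamma> i"
  shows "presents n (apply_words w P) G l"
proof -
  obtain G0 l0 where G0: "(G0, l0) \<in> iso_class n H m" and change: "ribbon_change n \<gamma> G0 l0 G l"
    using self G unfolding canonically_self_def by (metis mem_act_id)
  have "(G0, l0) \<in> ordered_graphs n"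
    using G0 by (auto simp: iso_class_def ordered_iso_def)
  then show ?thesis
    using ribbon_change_iff[where w = w and \<gamma> = \<gamma>, OF _ presents_iso_class[OF G G0 P] w] change by blast
qed

lemma canonically_self_conjugate:
  assumes self: "canonically_self n \<gamma> (iso_class n H m)"
    and inverse: "\<And>i. i \<in> {1..n} \<Longrightarrow> op_mult (\<beta> i) (\<alpha> i) = op_one"
    and conj: "\<And>i. i \<in> {1..n} \<Longrightarrow> \<gamma>' i = op_mult (op_mult (\<alpha> i) (\<gamma> i)) (\<beta> i)"
  shows "canonically_self n \<gamma>' (act n (\<alpha>, id) (iso_class n H m))"
proof -
  let ?C = "iso_class n H m"
  let ?K = "act n (\<alpha>, id) ?C"
  obtain word where word: "\<And>x. op_of_word (word x) = x"
    using op_of_word_surj by metis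
  define a g b where "a = word \<circ> \<alpha>" and "g = word \<circ> \<gamma>" and "b = word \<circ> \<beta>"
  then have a: "op_of_word (a i) = \<alpha> i" and g: "op_of_word (g i) = \<gamma> i"
    and b: "op_of_word (b i) = \<beta> i" for i
    by (simp_all add: word)
  define w where "w i = (a i @ g i) @ b i" for i
  have w: "op_of_word (w i) = \<gamma>' i" if "i \<in> {1..n}" for i
    by (simp add: w_def op_of_word_append a g b conj[OF that] del: append_assoc)
  \<comment> \<open>the inverse cancels the operation that led to \<open>K\<close>, and \<open>\<gamma>\<close> keeps presentations of \<open>G\<close> such\<close>
  have key: "ribbon_change n \<gamma>' K k X x \<longleftrightarrow> ribbon_change n \<alpha> G l X x"
    if G: "(G, l) \<in> ?C" and K: "(K, k) \<in> ordered_graphs n"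
      and change: "ribbon_change n \<alpha> G l K k" for G l K k X x
  proof -
    have Go: "(G, l) \<in> ordered_graphs n" using G by (auto simp: iso_class_def ordered_iso_def)
    obtain P where P: "presents n P G l" using change unfolding ribbon_change_def by blast
    note change_iff = ribbon_change_iff[where w = a and \<gamma> = \<alpha>, OF Go P a]
    have aP: "presents n (apply_words a P) K k"
      using change change_iff by blast
    have "op_of_word (w i @ a i) = op_of_word (a i @ g i)" if "i \<in> {1..n}" for i
    proof -
      have "op_of_word (w i @ a i) = op_mult (op_of_word (a i @ g i)) (op_of_word (b i @ a i))"
        by (simp add: w_def flip: op_of_word_append)
      also have "op_of_word (b i @ a i) = op_of_word []"
        using inverse[OF that] by (simp add: op_of_word_append a b op_of_word_Nil)
      finally show ?thesis by (simp flip: op_of_word_append)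
    qed
    then have "turn_equiv (apply_words w (apply_words a P)) (apply_words a (apply_words g P))"
      unfolding apply_words_append[symmetric]
      by (intro apply_words_cong[OF presents_labels[OF P]]) simp_all
    moreover have "turn_equiv (apply_words a (apply_words g P)) (apply_words a P)"
      using apply_words_turn_equiv presents_unique[OF Go] P self_presentation[where w = g, OF self G P g] by blast
    ultimately have same: "turn_equiv (apply_words w (apply_words a P)) (apply_words a P)"
      by (rule turn_equiv_trans)
    have "ribbon_change n \<gamma>' K k X x \<longleftrightarrow> presents n (apply_words w (apply_words a P)) X x"
      by (rule ribbon_change_iff[where w = w and \<gamma> = \<gamma>', OF K aP w])
    also have "\<dots> \<longleftrightarrow> presents n (apply_words a P) X x"
      using same turn_equiv_sym presents_turn_equiv by blast
    also have "\<dots> \<longleftrightarrow> ribbon_change n \<alpha> G l X x"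
      using change_iff by blast
    finally show ?thesis .
  qed
  have "act n (\<gamma>', id) ?K = ?K"
  proof (intro equalityI subrelI)
    fix X x assume "(X, x) \<in> act n (\<gamma>', id) ?K"
    then show "(X, x) \<in> ?K" unfolding mem_act_id using key by blast
  next
    fix X x assume "(X, x) \<in> ?K"
    moreover from this have "ribbon_change n \<gamma>' X x X x"
      unfolding mem_act_id using key by blast
    ultimately show "(X, x) \<in> act n (\<gamma>', id) ?K"
      unfolding mem_act_id[of X x n \<gamma>'] using mem_act_id by blast
  qed
  then show ?thesis unfolding canonically_self_def .
qed

theorem proposition6p2:
  fixes n :: nat and H :: "'a ribbon_graph" and lH :: "nat \<Rightarrow> 'a set"
    and \<gamma> :: "nat \<Rightarrow> ribbon_op"
  assumes "n \<ge> 1"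
    and "(H, lH) \<in> ordered_graphs n"
    and "oeb H"
    and "\<gamma> \<in> carrier (ribbon_group_power n)"
    and "\<gamma> \<noteq> \<one>\<^bsub>ribbon_group_power n\<^esub>"
    and "canonically_self n \<gamma> (iso_class n H lH)"
  shows "\<forall>K \<in> Orb_id n (iso_class n H lH).
           \<exists>\<gamma>' \<in> carrier (ribbon_group_power n).
             (\<exists>\<alpha> \<in> carrier (ribbon_group_power n).
                \<gamma>' = \<alpha> \<otimes>\<^bsub>ribbon_group_power n\<^esub> \<gamma> \<otimes>\<^bsub>ribbon_group_power n\<^esub> inv\<^bsub>ribbon_group_power n\<^esub> \<alpha>) \<and>
             canonically_self n \<gamma>' K"
proof
  fix K assume "K \<in> Orb_id n (iso_class n H lH)"
  then obtain \<alpha> where \<alpha>: "\<alpha> \<in> carrier (ribbon_group_power n)" and K: "K = act n (\<alpha>, id) (iso_class n H lH)"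
    unfolding Orb_id_def by blast
  let ?R = "ribbon_group_power n"
  interpret R: group ?R
    unfolding ribbon_group_power_def by (simp add: group_ribbon_group)
  define \<beta> where "\<beta> = inv\<^bsub>?R\<^esub> \<alpha>"
  define \<gamma>' where "\<gamma>' = \<alpha> \<otimes>\<^bsub>?R\<^esub> \<gamma> \<otimes>\<^bsub>?R\<^esub> \<beta>"
  have mult: "(x \<otimes>\<^bsub>?R\<^esub> y) i = op_mult (x i) (y i)" if "i \<in> {1..n}" for x y i
    using that by (simp add: ribbon_group_power_def ribbon_group_def)
  have "\<gamma>' \<in> carrier ?R"
    using \<alpha> assms(4) by (simp add: \<gamma>'_def \<beta>_def)
  moreover have "canonically_self n \<gamma>' K"
    unfolding K
  proof (rule canonically_self_conjugate[OF assms(6)])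
    fix i assume i: "i \<in> {1..n}"
    have "\<beta> \<otimes>\<^bsub>?R\<^esub> \<alpha> = \<one>\<^bsub>?R\<^esub>" using \<alpha> by (simp add: \<beta>_def)
    then have "op_mult (\<beta> i) (\<alpha> i) = \<one>\<^bsub>?R\<^esub> i" using mult[OF i] by metis
    then show "op_mult (\<beta> i) (\<alpha> i) = op_one"
      using i by (simp add: ribbon_group_power_def ribbon_group_def)
    show "\<gamma>' i = op_mult (op_mult (\<alpha> i) (\<gamma> i)) (\<beta> i)"
      by (simp add: \<gamma>'_def mult[OF i])
  qed
  ultimately show "\<exists>\<gamma>' \<in> carrier ?R.
      (\<exists>\<alpha> \<in> carrier ?R. \<gamma>' = \<alpha> \<otimes>\<^bsub>?R\<^esub> \<gamma> \<otimes>\<^bsub>?R\<^esub> inv\<^bsub>?R\<^esub> \<alpha>) \<and> canonically_self n \<gamma>' K"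
    using \<alpha> unfolding \<gamma>'_def \<beta>_def by blast
qed

end
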